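(* Let $\hat\mu(X,\delta)$ denote the output of the Main Estimator described in the context on a sample $X=(x_1,\dots,x_n)$ with confidence parameter $\delta$. For every $\xi>0$ there exists $\tau>0$ such that for every $n\in\mathbb{N}$ and $\delta\in(0,1)$ with $\frac{\log(1/\delta)}{n}<\tau$ and $\delta<\tau$, and for every probability distribution $D$ on $\mathbb{R}$ with finite variance, with mean $\mu(D)$ and standard deviation $\sigma(D)$, if $X$ consists of $n$ independent samples from $D$, then with probability at least $1-\delta$, $$|\hat\mu(X,\delta)-\mu(D)|\le \sigma(D)\,(1+\xi)\sqrt{\frac{2\log\frac1\delta}{n}}.$$ (That is, the error is at most $\sigma(D)(1+o(1))\sqrt{2\log(1/\delta)/n}$, where the $o(1)$ term does not depend on $D$ and tends to $0$ as $(\frac{\log(1/\delta)}{n},\delta)\to(0,0)$.) Furthermore, no estimator improves on this guarantee by more than a $1+o(1)$ multiplicative factor, already for Gaussian distributions: for every $\xi\in(0,1)$ there exists $\tau>0$ such that for all $n\in\mathbb{N}$, $\delta\in(0,1)$ with $\frac{\log(1/\delta)}{n}<\tau$ and $\delta<\tau$, there is no (measurable) function $g:\mathbb{R}^n\to\mathbb{R}$ such that for every Gaussian distribution $D$ on $\mathbb{R}$, $$\Pr_{X\leftarrow D^n}\left(|g(X)-\mu(D)|\le \sigma(D)(1-\xi)\sqrt{\frac{2\log\frac1\delta}{n}}\right)\ge 1-\delta .$$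
   Context: All logarithms are natural. $X\leftarrow D^n$ means $X=(x_1,\dots,x_n)$ with i.i.d. entries of law $D$. Main Estimator (inputs: $x_1,\dots,x_n\in\mathbb{R}$ and $\delta\in(0,1)$): 1. Compute the median-of-means estimate $\kappa$: evenly partition the data into $\log\frac1\delta$ groups and let $\kappa$ be the median of the set of means of the groups. (Conventions: the number of groups is $\lceil\log\frac1\delta\rceil$, assumed at most $n$; the partition is a fixed partition of the index set $\{1,\dots,n\}$ depending only on $n,\delta$, with group sizes differing by at most $1$; the median of an even number of values is the average of the two middle values.) 2. Find the solution $\alpha>0$ of the monotone, piecewise-linear equation $\sum_{i=1}^n\min(\alpha(x_i-\kappa)^2,1)=\frac13\log\frac1\delta$. 3. Output $\hat\mu=\kappa+\frac1n\sum_{i=1}^n(x_i-\kappa)\left(1-\min(\alpha(x_i-\kappa)^2,1)\right)$. (Convention: if the equation in step 2 has no solution, i.e. fewer than $\frac13\log\frac1\delta$ of the $x_i$ differ from $\kappa$, then $\alpha$ is read as $+\infty$ and the output is $\hat\mu=\kappa$. If the solution is not unique, the output does not depend on the choice.) *)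

theory Defs
  imports "HOL-Probability.Probability"
begin

definition mean :: "real measure \<Rightarrow> real" where
  "mean D = prob_space.expectation D (\<lambda>x. x)"

definition std_dev :: "real measure \<Rightarrow> real" where
  "std_dev D = sqrt (prob_space.variance D (\<lambda>x. x))"

definition gaussian :: "real measure \<Rightarrow> bool" where
  "gaussian D \<longleftrightarrow> (\<exists>\<mu> \<sigma>. \<sigma> > 0 \<and> D = density lborel (normal_density \<mu> \<sigma>))"

text \<open>A point of \<open>\<real>\<^sup>n\<close> is a function on \<open>{..<n}\<close>; only its values there are used.\<close>

abbreviation iid :: "nat \<Rightarrow> real measure \<Rightarrow> (nat \<Rightarrow> real) measure" where
  "iid n D \<equiv> Pi\<^sub>M {..<n} (\<lambda>_. D)"

definition median :: "real list \<Rightarrow> real" where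
  "median xs =
    (let ys = sort xs; k = length xs
     in if odd k then ys ! (k div 2) else (ys ! (k div 2 - 1) + ys ! (k div 2)) / 2)"

definition num_groups :: "real \<Rightarrow> nat" where
  "num_groups \<delta> = nat \<lceil>ln (1 / \<delta>)\<rceil>"

definition balanced_partition :: "nat \<Rightarrow> nat \<Rightarrow> (nat \<Rightarrow> nat set) \<Rightarrow> bool" where
  "balanced_partition n k G \<longleftrightarrow>
    (\<Union>j<k. G j) = {..<n} \<and> disjoint_family_on G {..<k} \<and>
    (\<forall>i<k. \<forall>j<k. card (G i) \<le> card (G j) + 1)"

text \<open>The estimator partitions the index set in some fixed way that depends on \<open>n\<close> and \<open>\<delta>\<close>
  only (not on the data); such a choice is a parameter here, \<open>P n \<delta> j\<close> being the \<open>j\<close>-th group.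
  Nothing is required of it when there would be more groups than samples.\<close>

definition partition_scheme :: "(nat \<Rightarrow> real \<Rightarrow> nat \<Rightarrow> nat set) \<Rightarrow> bool" where
  "partition_scheme P \<longleftrightarrow>
    (\<forall>n \<delta>. 0 < \<delta> \<and> \<delta> < 1 \<and> num_groups \<delta> \<le> n \<longrightarrow>
      balanced_partition n (num_groups \<delta>) (P n \<delta>))"

definition median_of_means ::
    "(nat \<Rightarrow> real \<Rightarrow> nat \<Rightarrow> nat set) \<Rightarrow> nat \<Rightarrow> real \<Rightarrow> (nat \<Rightarrow> real) \<Rightarrow> real" where
  "median_of_means P n \<delta> x =
    median (map (\<lambda>j. (\<Sum>i\<in>P n \<delta> j. x i) / real (card (P n \<delta> j))) [0..<num_groups \<delta>])"

definition truncation_eq :: "nat \<Rightarrow> real \<Rightarrow> (nat \<Rightarrow> real) \<Rightarrow> real \<Rightarrow> real \<Rightarrow> bool" where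
  "truncation_eq n \<delta> x \<kappa> \<alpha> \<longleftrightarrow>
    \<alpha> > 0 \<and> (\<Sum>i<n. min (\<alpha> * (x i - \<kappa>)\<^sup>2) 1) = 1/3 * ln (1 / \<delta>)"

text \<open>If there are several solutions \<open>\<alpha>\<close>, then all of them give the same output. If there is
  none, then \<open>\<alpha>\<close> is read as \<open>+\<infinity>\<close>, which makes every summand of the correction vanish.\<close>

definition main_estimator ::
    "(nat \<Rightarrow> real \<Rightarrow> nat \<Rightarrow> nat set) \<Rightarrow> nat \<Rightarrow> real \<Rightarrow> (nat \<Rightarrow> real) \<Rightarrow> real" where
  "main_estimator P n \<delta> x =
    (let \<kappa> = median_of_means P n \<delta> x in
     if \<exists>\<alpha>. truncation_eq n \<delta> x \<kappa> \<alpha>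
     then let \<alpha> = (SOME \<alpha>. truncation_eq n \<delta> x \<kappa> \<alpha>) in
       \<kappa> + 1 / real n * (\<Sum>i<n. (x i - \<kappa>) * (1 - min (\<alpha> * (x i - \<kappa>)\<^sup>2) 1))
     else \<kappa>)"

end

theory Submission imports Defs begin

text \<open>Write \<open>L = ln (1/\<delta>)\<close> and \<open>u = \<sigma> sqrt (L/n)\<close>, so that the claimed error is \<open>sqrt 2 (1 + \<xi>) u\<close>.

\<^bold>\<open>Upper bound.\<close> The output is the value of \<open>truncated_mean\<close> at a random centre \<open>\<kappa>\<close> and a random
scale \<open>s = sqrt \<alpha>\<close>, and at that pair the truncation sum \<open>load\<close> equals \<open>L/3\<close>. Suppose first that the pair
\<open>(\<kappa>, s)\<close> is deterministic, and put \<open>y = s (x - \<kappa>)\<close>. The deviation and the load are sums of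
\<open>psi y = y (1 - min y\<^sup>2 1)\<close> and \<open>rho y = min y\<^sup>2 1\<close> over the sample. If weights \<open>a, b, c\<close> satisfy
\<open>exp (a psi y + b rho y) \<le> 1 + a y + c y\<^sup>2\<close> for all \<open>y\<close>, then the exponential moment of
\<open>a n s (truncated_mean - \<mu>) + b load\<close> only involves the variance and is about \<open>exp (c \<beta>\<^sup>2 L)\<close> for
\<open>s = \<beta> L / (n u)\<close>; the contribution of the centre cancels in first order. A deviation of
\<open>sqrt 2 (1 + \<xi>) u\<close> together with load \<open>L/3\<close> makes this combination at least
\<open>L (sqrt 2 (1 + \<xi>) a \<beta> + b/3)\<close>. Hence the event has probability at most \<open>exp (- (1 + \<eta>) L)\<close>, for
some \<open>\<eta> > 0\<close>, as soon as \<open>1 + c \<beta>\<^sup>2 \<le> sqrt 2 a \<beta> + b/3\<close>.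

That such weights exist for every \<open>\<beta>\<close> that is not very small is the heart of the matter
(\<open>chernoff_weights\<close>). Except for large \<open>\<beta>\<close>, where there is room to spare, they form an explicit curve along which the derivative of the gap between \<open>ln (1 + a y + c y\<^sup>2)\<close> and
\<open>a psi y + b rho y\<close> has the perfect square factor \<open>(t - 2 g)\<^sup>2\<close>, where \<open>t = a y\<close>
(\<open>weights_tangent\<close>). The point \<open>g = 0\<close> of the curve has \<open>b = 0\<close>, \<open>a = sqrt 6\<close> and \<open>\<beta>\<^sup>2 = 1/3\<close>. There the expansions of
the two sides agree up to third order, and without truncation the mean of the load is \<open>\<beta>\<^sup>2 L\<close>, which
singles out the constant \<open>1/3\<close> of the estimator.

The true centre and scale are random, so a union bound over a finite grid is taken. The size of the grid depends only on
\<open>\<xi>\<close> and is absorbed by \<open>exp (- \<eta> L)\<close>. It suffices because the estimate and the load are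
Lipschitz in the centre, because a change of scale moves the estimate by at most the change of the load divided by
\<open>n\<close> times the smaller scale (\<open>truncated_mean_scale\<close>), so that all very large scales, including \<open>\<alpha> = \<infinity>\<close>, may be replaced by one large
scale, and because very small scales are already unlikely for the load alone
(\<open>ex_test_family\<close>). Finally the median of means is within a constant multiple of \<open>u\<close> of the mean,
except with probability at most \<open>\<delta>/2\<close> (\<open>median_of_means_concentration\<close>).

\<^bold>\<open>Lower bound.\<close> An estimator with error radius \<open>r\<close> distinguishes two unit Gaussians with means
\<open>\<plusminus> t\<close> as soon as \<open>t > r\<close>. Seen from the Gaussian with mean \<open>0\<close>, the likelihood ratio of either
of them is at least \<open>exp (- n t\<^sup>2 / 2 - 2 t sqrt n)\<close> on an event of probability at least \<open>3/4\<close>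
(\<open>unit_gaussian_shift_measure_ge\<close>), so under one of these two means the error probability is at least a quarter of that ratio. For
\<open>t = (1 - \<xi>/2) sqrt (2 L / n)\<close> this is \<open>exp (- (1 - \<xi>/2)\<^sup>2 L - O (sqrt L))\<close>, which exceeds \<open>4 \<delta>\<close> for small \<open>\<delta>\<close>.\<close>

section \<open>Truncation of a standardised observation\<close>

definition rho :: "real \<Rightarrow> real" where "rho y = min (y\<^sup>2) 1"
definition psi :: "real \<Rightarrow> real" where "psi y = y * (1 - rho y)"

text \<open>In terms of the projection to \<open>[-1, 1]\<close> both functions are polynomials, which gives their Lipschitz
constants without a case distinction.\<close>

definition clamp :: "real \<Rightarrow> real" where "clamp y = max (-1) (min y 1)"

lemma rho_clamp: "rho y = (clamp y)\<^sup>2"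
proof (cases "\<bar>y\<bar> \<le> 1")
  case True then show ?thesis by (auto simp: rho_def clamp_def abs_square_le_1 min_def max_def)
next
  case False
  then have "1 \<le> y\<^sup>2" by (metis abs_1 abs_le_square_iff less_eq_real_def not_le one_power2)
  then show ?thesis using False by (auto simp: rho_def clamp_def min_def max_def)
qed

lemma psi_clamp: "psi y = clamp y - clamp y ^ 3"
proof (cases "\<bar>y\<bar> \<le> 1")
  case True then show ?thesis
    by (auto simp: psi_def rho_clamp clamp_def power2_eq_square power3_eq_cube algebra_simps)
next
  case False
  then show ?thesis by (auto simp: psi_def rho_clamp clamp_def min_def max_def)
qed

lemma clamp_bounds: "\<bar>clamp y\<bar> \<le> 1" and clamp_lipschitz: "\<bar>clamp y - clamp z\<bar> \<le> \<bar>y - z\<bar>"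
  by (auto simp: clamp_def)

lemma rho_bounds: "0 \<le> rho y" "rho y \<le> 1"
  by (auto simp: rho_def)

lemma rho_minus [simp]: "rho (- y) = rho y" and psi_minus: "psi (- y) = - psi y"
  by (simp_all add: rho_def psi_def)

lemma rho_lipschitz: "\<bar>rho y - rho z\<bar> \<le> 2 * \<bar>y - z\<bar>"
proof -
  have "\<bar>rho y - rho z\<bar> = \<bar>clamp y + clamp z\<bar> * \<bar>clamp y - clamp z\<bar>"
    unfolding rho_clamp abs_mult[symmetric] by (simp add: algebra_simps power2_eq_square)
  also have "\<dots> \<le> 2 * \<bar>y - z\<bar>"
    using clamp_bounds[of y] clamp_bounds[of z] clamp_lipschitz[of y z] by (intro mult_mono) auto
  finally show ?thesis .
qed

lemma psi_lipschitz: "\<bar>psi y - psi z\<bar> \<le> 2 * \<bar>y - z\<bar>"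
proof -
  let ?c = "clamp y" and ?d = "clamp z"
  have "?c\<^sup>2 \<le> 1" "?d\<^sup>2 \<le> 1" using clamp_bounds by (auto simp: abs_square_le_1)
  moreover have "0 \<le> (?c + ?d)\<^sup>2" "0 \<le> (?c - ?d)\<^sup>2" by auto
  ultimately have "\<bar>1 - (?c\<^sup>2 + ?c * ?d + ?d\<^sup>2)\<bar> \<le> 2"
    unfolding power2_sum power2_diff by linarith
  moreover have "\<bar>psi y - psi z\<bar> = \<bar>1 - (?c\<^sup>2 + ?c * ?d + ?d\<^sup>2)\<bar> * \<bar>?c - ?d\<bar>"
    unfolding psi_clamp abs_mult[symmetric]
    by (simp add: algebra_simps power2_eq_square power3_eq_cube)
  ultimately show ?thesis using clamp_lipschitz[of y z]
    by (simp add: mult_mono)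
qed

lemma rho_scale_mono: "0 \<le> s' \<Longrightarrow> s' \<le> s \<Longrightarrow> rho (s' * d) \<le> rho (s * d)"
  unfolding rho_def power_mult_distrib by (intro min.mono mult_right_mono power_mono) auto

lemma rho_scale_le:
  assumes "0 \<le> s" "s \<le> h * s'" "h \<ge> 1"
  shows "rho (s * d) \<le> h\<^sup>2 * rho (s' * d)"
proof -
  have "(s * d)\<^sup>2 \<le> (h * s')\<^sup>2 * d\<^sup>2"
    unfolding power_mult_distrib[of s d] using assms by (intro mult_right_mono power_mono) auto
  moreover have "1 \<le> h\<^sup>2" using assms by simp
  ultimately show ?thesis unfolding rho_def by (auto simp: min_def power_mult_distrib algebra_simps)
qed


section \<open>Exponential weights at every truncation scale\<close>

text \<open>With \<open>t = a y\<close>, \<open>B = b / a\<^sup>2\<close>, \<open>r = 1 / a\<^sup>2\<close> and \<open>C = c / a\<^sup>2\<close>, this is the slack in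
\<open>a psi y + b rho y \<le> ln (1 + a y + c y\<^sup>2)\<close> for \<open>\<bar>y\<bar> \<le> 1\<close>.\<close>

definition log_gap :: "real \<Rightarrow> real \<Rightarrow> real \<Rightarrow> real \<Rightarrow> real" where
  "log_gap C B r t = ln (1 + t + C * t\<^sup>2) - t - B * t\<^sup>2 + r * t ^ 3"

lemma quadratic_ge:
  fixes C t :: real
  assumes "C > 0"
  shows "1 + t + C * t\<^sup>2 \<ge> 1 - 1 / (4 * C)"
proof -
  have "0 \<le> C * (t + 1 / (2 * C))\<^sup>2" using assms by simp
  also have "\<dots> = t + C * t\<^sup>2 + 1 / (4 * C)"
    using assms by (simp add: power2_eq_square field_simps)
  finally show ?thesis by simp
qed

lemma quadratic_pos:
  fixes C t :: real
  assumes "4 * C > 1"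
  shows "1 + t + C * t\<^sup>2 > 0"
proof -
  have "1 - 1 / (4 * C) > 0" using assms by (simp add: field_simps)
  with quadratic_ge[of C t] assms show ?thesis by linarith
qed

text \<open>The logarithm disappears on differentiation, so the sign of the slack is governed by a cubic polynomial.\<close>

lemma log_gap_deriv:
  assumes "4 * C > 1"
  shows "(log_gap C B r has_real_derivative
    t * ((2*C - 1 - 2*B) + (3*r - C - 2*B) * t + (3*r - 2*B*C) * t\<^sup>2 + 3*r*C * t^3)
      / (1 + t + C * t\<^sup>2)) (at t)"
proof -
  note pos = quadratic_pos[OF assms, of t]
  have "(log_gap C B r has_real_derivative
     (1 + 2 * C * t) / (1 + t + C * t\<^sup>2) - 1 - 2 * B * t + 3 * r * t\<^sup>2) (at t)"
    unfolding log_gap_def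
    by (rule derivative_eq_intros refl pos)+ (simp add: field_simps power2_eq_square)
  also have "(1 + 2 * C * t) / (1 + t + C * t\<^sup>2) - 1 - 2 * B * t + 3 * r * t\<^sup>2 =
    t * ((2*C - 1 - 2*B) + (3*r - C - 2*B) * t + (3*r - 2*B*C) * t\<^sup>2 + 3*r*C * t^3)
      / (1 + t + C * t\<^sup>2)"
    using pos by (simp add: field_simps) algebra
  finally show ?thesis .
qed

lemma log_gap_nonneg:
  assumes C: "4 * C > 1" and "T \<ge> 0" "t \<ge> -T"
    and p: "\<And>t. t \<ge> -T \<Longrightarrow> (2*C - 1 - 2*B) + (3*r - C - 2*B) * t + (3*r - 2*B*C) * t\<^sup>2 + 3*r*C * t^3 \<ge> 0"
  shows "log_gap C B r t \<ge> 0"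
proof (cases "t \<ge> 0")
  case True
  have "log_gap C B r 0 \<le> log_gap C B r t"
  proof (rule DERIV_nonneg_imp_nondecreasing[OF True])
    fix x :: real assume "0 \<le> x" "x \<le> t"
    show "\<exists>y. (log_gap C B r has_real_derivative y) (at x) \<and> y \<ge> 0"
      by (intro exI[of _ "x * _ / _"] conjI, rule log_gap_deriv[OF C])
        (use p[of x] quadratic_pos[OF C, of x] \<open>T \<ge> 0\<close> \<open>0 \<le> x\<close> in
          \<open>auto intro!: divide_nonneg_pos mult_nonneg_nonneg\<close>)
  qed
  then show ?thesis by (simp add: log_gap_def)
next
  case False
  have "log_gap C B r t \<ge> log_gap C B r 0"
  proof (rule DERIV_nonpos_imp_nonincreasing[where f = "log_gap C B r"])
    show "t \<le> 0" using False by simp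
    fix x :: real assume "t \<le> x" "x \<le> 0"
    show "\<exists>y. (log_gap C B r has_real_derivative y) (at x) \<and> y \<le> 0"
      by (intro exI[of _ "x * _ / _"] conjI, rule log_gap_deriv[OF C])
        (use p[of x] quadratic_pos[OF C, of x] \<open>t \<ge> -T\<close> \<open>t \<le> x\<close> \<open>x \<le> 0\<close> in
          \<open>auto intro!: divide_nonpos_pos mult_nonpos_nonneg\<close>)
  qed
  then show ?thesis by (simp add: log_gap_def)
qed

lemma exp_psi_rho_le:
  assumes "a > 0" "4 * C > 1"
    and gap: "\<And>t. \<bar>t\<bar> \<le> a \<Longrightarrow> log_gap C (b / a\<^sup>2) (1 / a\<^sup>2) t \<ge> 0"
    and out: "\<And>y. \<bar>y\<bar> \<ge> 1 \<Longrightarrow> exp b \<le> 1 + a * y + C * a\<^sup>2 * y\<^sup>2"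
  shows "exp (a * psi y + b * rho y) \<le> 1 + a * y + C * a\<^sup>2 * y\<^sup>2"
proof (cases "\<bar>y\<bar> \<le> 1")
  case True
  define t where "t = a * y"
  have "\<bar>t\<bar> \<le> a" using True assms(1) by (simp add: t_def abs_mult mult_left_le)
  have rho: "rho y = y\<^sup>2" using True by (simp add: rho_def abs_square_le_1)
  have "a * psi y + b * rho y = t + b / a\<^sup>2 * t\<^sup>2 - 1 / a\<^sup>2 * t^3"
    using assms(1) by (simp add: psi_def rho t_def field_simps power2_eq_square power3_eq_cube)
  also have "\<dots> \<le> ln (1 + t + C * t\<^sup>2)"
    using gap[OF \<open>\<bar>t\<bar> \<le> a\<close>] by (simp add: log_gap_def)
  finally have "exp (a * psi y + b * rho y) \<le> 1 + t + C * t\<^sup>2"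
    using quadratic_pos[OF assms(2), of t] by (metis exp_le_cancel_iff exp_ln)
  then show ?thesis by (simp add: t_def power_mult_distrib mult.assoc)
next
  case False
  then have "1 \<le> y\<^sup>2" by (metis abs_1 abs_le_square_iff less_eq_real_def not_le one_power2)
  then have "rho y = 1" "psi y = 0" by (simp_all add: rho_def psi_def)
  with out[of y] False show ?thesis by simp
qed


lemma exp_double_le:
  fixes g :: real
  assumes "0 \<le> g" "g < 1"
  shows "exp (2 * g) \<le> (1 + g) / (1 - g)"
proof -
  let ?h = "\<lambda>x::real. ln (1 + x) - ln (1 - x) - 2 * x"
  have "?h 0 \<le> ?h g"
  proof (rule DERIV_nonneg_imp_nondecreasing[OF assms(1)])
    fix x :: real assume x: "0 \<le> x" "x \<le> g"
    with assms have x1: "x < 1" by simp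
    have "(?h has_real_derivative 1 / (1 + x) + 1 / (1 - x) - 2) (at x)"
      using x x1 by (auto intro!: derivative_eq_intros)
    moreover have "1 / (1 + x) + 1 / (1 - x) - 2 = 2 * x\<^sup>2 / ((1 + x) * (1 - x))"
    proof -
      have "1 / (1 + x) + 1 / (1 - x) = 2 / ((1 + x) * (1 - x))"
        using x x1 by (simp add: divide_simps)
      also have "\<dots> - 2 = (2 - 2 * ((1 + x) * (1 - x))) / ((1 + x) * (1 - x))"
        using x x1 by (simp add: divide_simps)
      also have "2 - 2 * ((1 + x) * (1 - x)) = 2 * x\<^sup>2" by (simp add: power2_eq_square algebra_simps)
      finally show ?thesis by simp
    qed
    moreover have "2 * x\<^sup>2 / ((1 + x) * (1 - x)) \<ge> 0" using x x1 by simp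
    ultimately show "\<exists>y. (?h has_real_derivative y) (at x) \<and> 0 \<le> y" by metis
  qed
  then have "2 * g \<le> ln ((1 + g) / (1 - g))" using assms by (simp add: ln_div)
  then show ?thesis using assms by (metis add_nonneg_pos diff_gt_0_iff_gt divide_pos_pos exp_le_cancel_iff exp_ln zero_less_one add.commute)
qed

text \<open>The weight inequality at \<open>y = -1\<close> for the curve of weights in \<open>weights_tangent\<close>. It is needed
only where \<open>a > 2\<close>, which is \<open>g > -1/3\<close>. The square root is replaced by its tangent. For \<open>g \<ge> 0\<close> the factor
\<open>exp (2 g)\<close> is bounded by its Pade approximant \<open>(1 + g) / (1 - g)\<close>, which has the same pole at
\<open>g = 1\<close> as the right-hand side.\<close>

lemma exp_endpoint:
  fixes g :: real
  assumes "-1/3 \<le> g" "g < 1"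
  shows "exp (3*g) \<le> 1 - sqrt (6 * (1 + g)) + 3 * (1 + g) / (1 - g)"
proof -
  \<comment> \<open>The tangent of the square root at \<open>25/4\<close>.\<close>
  have sq: "sqrt (6 * (1 + g)) \<le> 49/20 + 6/5 * g"
  proof (rule real_le_lsqrt)
    have "0 \<le> (g*6/5 - 1/20)\<^sup>2" by simp
    then show "6 * (1 + g) \<le> (49/20 + 6/5 * g)\<^sup>2"
      by (simp add: power2_eq_square algebra_simps)
  qed (use assms in auto)
  show ?thesis
  proof (cases "g \<ge> 0")
    case True
    have "exp (3*g) = exp (2*g) * exp g" by (simp add: exp_add[symmetric])
    also have "\<dots> \<le> (1 + g) / (1 - g) * (1 + g + g\<^sup>2)"
      using exp_double_le[of g] exp_bound[of g] True assms
      by (intro mult_mono) auto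
    also have "\<dots> = 3 * (1 + g) / (1 - g) - (1 + g) * (2 + g)"
      using assms by (simp add: field_simps power2_eq_square)
    finally have "exp (3*g) \<le> 3 * (1 + g) / (1 - g) - (1 + g) * (2 + g)" .
    moreover have "(1 + g) * (2 + g) = 2 + 3 * g + g\<^sup>2"
      by (simp add: algebra_simps power2_eq_square)
    ultimately show ?thesis using sq True zero_le_power2[of g] by linarith
  next
    case False
    define x where "x = - g"
    have x: "0 < x" "x \<le> 1/3" using False assms by (auto simp: x_def)
    have "1 + 3*x + 9/2*x\<^sup>2 \<le> exp (3*x)"
      using exp_lower_Taylor_quadratic[of "3*x"] x by (simp add: power_mult_distrib)
    then have "exp (- (3*x)) \<le> 1 / (1 + 3*x + 9/2*x\<^sup>2)"
      using x by (simp add: exp_minus inverse_eq_divide frac_le add_pos_nonneg)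
    also have "\<dots> \<le> - 29/20 + 6/5 * x + 3 * (1 - x) / (1 + x)"
    proof -
      have "x\<^sup>2 \<le> x / 3" using x by (simp add: power2_eq_square)
      moreover have "x^3 \<le> x / 9"
      proof -
        have "x * x\<^sup>2 \<le> x * (1/9)"
          using x power_mono[of x "1/3" 2] by (intro mult_left_mono) (auto simp: power2_eq_square)
        then show ?thesis by (simp add: power3_eq_cube power2_eq_square)
      qed
      moreover have "0 \<le> x^4" by simp
      ultimately have "1 + x \<le> 155/100 + 14/10*x - 1575/1000*x\<^sup>2 - 11025/1000*x^3 + 54/10*x^4"
        using x by linarith
      also have "\<dots> = (1 + 3*x + 9/2*x\<^sup>2) * ((- 29/20 + 6/5 * x) * (1 + x) + 3 * (1 - x))"
        by (simp add: field_simps power2_eq_square power3_eq_cube power4_eq_xxxx)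
      also have "\<dots> = (- 29/20 + 6/5 * x + 3 * (1 - x) / (1 + x)) * ((1 + 3*x + 9/2*x\<^sup>2) * (1 + x))"
      proof -
        have "(- 29/20 + 6/5 * x) * (1 + x) + 3 * (1 - x)
            = (- 29/20 + 6/5 * x + 3 * (1 - x) / (1 + x)) * (1 + x)"
          using x by (simp add: distrib_right)
        then show ?thesis by simp
      qed
      finally have "1 + x \<le> (- 29/20 + 6/5 * x + 3 * (1 - x) / (1 + x)) * (1 + 3*x + 9/2*x\<^sup>2) * (1 + x)"
        by (simp add: mult.assoc)
      moreover have "1 + 3*x + 9/2*x\<^sup>2 > 0" using x by (simp add: add_pos_nonneg)
      ultimately show ?thesis using x by (simp add: pos_divide_le_eq)
    qed
    finally show ?thesis using sq by (simp add: x_def)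
  qed
qed

text \<open>By convexity it is enough to check the two ends of the interval.\<close>

lemma exp_le_half_line:
  fixes g :: real
  assumes "-4/5 \<le> g" "g \<le> -1/2"
  shows "exp (3 * g) \<le> (1 + g) / 2"
proof -
  define v where "v = (g + 4/5) * (10/3)"
  have v: "0 \<le> v" "v \<le> 1" using assms by (auto simp: v_def)
  have "exp (-12/5::real) \<le> 1/10"
  proof -
    have "1 + 6/25 + (6/25)\<^sup>2/2 \<le> exp (6/25::real)"
      by (rule exp_lower_Taylor_quadratic) simp
    then have "(1 + 6/25 + (6/25)\<^sup>2/2)^10 \<le> exp (6/25::real)^10" by (intro power_mono) auto
    moreover have "(10::real) \<le> (1 + 6/25 + (6/25)\<^sup>2/2)^10" by (simp add: power2_eq_square power_divide)
    ultimately have "10 \<le> exp (12/5::real)" by (simp add: exp_of_nat_mult[symmetric])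
    then show ?thesis by (simp add: exp_minus inverse_eq_divide field_simps)
  qed
  moreover have "exp (-3/2::real) \<le> 1/4"
  proof -
    have "1 + 3/20 + (3/20)\<^sup>2/2 \<le> exp (3/20::real)"
      by (rule exp_lower_Taylor_quadratic) simp
    then have "(1 + 3/20 + (3/20)\<^sup>2/2)^10 \<le> exp (3/20::real)^10" by (intro power_mono) auto
    moreover have "(4::real) \<le> (1 + 3/20 + (3/20)\<^sup>2/2)^10" by (simp add: power2_eq_square power_divide)
    ultimately have "4 \<le> exp (3/2::real)" by (simp add: exp_of_nat_mult[symmetric])
    then show ?thesis by (simp add: exp_minus inverse_eq_divide field_simps)
  qed
  moreover have "exp ((1 - v) * (-12/5) + v * (-3/2)) \<le> (1 - v) * exp (-12/5) + v * exp (-3/2::real)"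
    using convex_onD[OF exp_convex, of v "-12/5" "-3/2"] v by simp
  moreover have "(1 - v) * (-12/5) + v * (-3/2) = 3 * g" by (simp add: v_def field_simps)
  ultimately have "exp (3*g) \<le> (1 - v) * (1/10) + v * (1/4)"
    using v by (smt (verit, ccfv_SIG) mult_left_mono)
  also have "\<dots> = (1 + g) / 2" by (simp add: v_def field_simps)
  finally show ?thesis .
qed

text \<open>The curve of weights. The choice of \<open>C\<close> in terms of \<open>g\<close> is the largest one compatible with the
requirement \<open>1 + c \<beta>\<^sup>2 \<le> sqrt 2 a \<beta> + b / 3\<close> for some \<open>\<beta>\<close>, and \<open>a\<close> gives the cubic of \<open>log_gap_deriv\<close> a double root at \<open>2 g\<close>, so that it
does not change sign there: it equals \<open>(t - 2 g)\<^sup>2 (t + 2)\<close> up to a positive factor. Hence the gap decreases towards \<open>t = 0\<close> from both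
sides on \<open>[-2, \<infinity>)\<close> and increases on \<open>(-\<infinity>, -2]\<close>, and for
\<open>\<bar>y\<bar> \<le> 1\<close> only the point \<open>y = -1\<close> needs a numerical estimate. For \<open>\<bar>y\<bar> \<ge> 1\<close> the left-hand side is
constant, and the minimum of the quadratic is relevant only for \<open>g \<le> -1/2\<close>.\<close>

lemma weights_tangent:
  fixes g :: real
  assumes g: "-4/5 \<le> g" "g < 1"
  defines "a \<equiv> sqrt (6 * (1 + g))" and "C \<equiv> 1 / (2 * (1 - g))"
  shows "exp (a * psi y + (3 * g) * rho y) \<le> 1 + a * y + C * a\<^sup>2 * y\<^sup>2"
proof (rule exp_psi_rho_le)
  have a2: "a\<^sup>2 = 6 * (1 + g)" using g by (simp add: a_def)
  show a0: "a > 0" using g by (simp add: a_def)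
  show C4: "4 * C > 1" using g by (simp add: C_def field_simps)
  let ?B = "3 * g / a\<^sup>2" let ?r = "1 / a\<^sup>2"
  have p: "(2*C - 1 - 2* ?B) + (3* ?r - C - 2* ?B) * t + (3* ?r - 2* ?B*C) * t\<^sup>2 + 3* ?r*C * t^3
     = (t - 2 * g)\<^sup>2 * (t + 2) / (4 * (1 + g) * (1 - g))" for t
  proof -
    let ?D = "4 * (1 + g) * (1 - g)"
    have "2*C - 1 - 2* ?B = 8 * g\<^sup>2 / ?D" "3* ?r - C - 2* ?B = (4 * g\<^sup>2 - 8 * g) / ?D"
      "3* ?r - 2* ?B*C = (2 - 4 * g) / ?D" "3* ?r*C = 1 / ?D"
      using g unfolding a2 C_def by (simp_all add: divide_simps) algebra+
    then show ?thesis
      by (simp add: add_divide_distrib[symmetric]) (simp add: algebra_simps power2_eq_square power3_eq_cube)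
  qed
  have p0: "(2*C - 1 - 2* ?B) + (3* ?r - C - 2* ?B) * t + (3* ?r - 2* ?B*C) * t\<^sup>2 + 3* ?r*C * t^3 \<ge> 0"
    if "t \<ge> -2" for t unfolding p using that g by simp
  have inner: "log_gap C ?B ?r t \<ge> 0" if "t \<ge> -2" for t
    by (rule log_gap_nonneg[OF C4, of 2]) (use that p0 in auto)
  have Ca2: "C * a\<^sup>2 = 3 * (1 + g) / (1 - g)" using g by (simp add: a2 C_def field_simps)
  have endp: "log_gap C ?B ?r (-a) \<ge> 0"
  proof (cases "a \<le> 2")
    case True then show ?thesis by (intro inner) simp
  next
    case False
    then have "a\<^sup>2 > 2\<^sup>2" by (intro power_strict_mono) auto
    then have "-1/3 \<le> g" by (simp add: a2)
    from exp_endpoint[OF this g(2)] have "exp (3*g) \<le> 1 - a + C * a\<^sup>2"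
      unfolding Ca2 by (simp only: a_def)
    then have "3 * g \<le> ln (1 - a + C * a\<^sup>2)"
      using quadratic_pos[OF C4, of "-a"] by (metis exp_le_cancel_iff exp_ln power2_minus uminus_add_conv_diff add.commute add_uminus_conv_diff)
    moreover have "log_gap C ?B ?r (-a) = ln (1 - a + C * a\<^sup>2) - 3 * g"
      using a0 by (simp add: log_gap_def power2_eq_square power3_eq_cube)
    ultimately show ?thesis by linarith
  qed
  show gap: "log_gap C ?B ?r t \<ge> 0" if "\<bar>t\<bar> \<le> a" for t
  proof (cases "t \<ge> -2")
    case True then show ?thesis by (rule inner)
  next
    case False
    have "log_gap C ?B ?r (-a) \<le> log_gap C ?B ?r t"
    proof (rule DERIV_nonneg_imp_nondecreasing[where f = "log_gap C ?B ?r"])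
      show "-a \<le> t" using that by simp
      fix x assume "-a \<le> x" "x \<le> t"
      then have "x < -2" using False by simp
      have "x * ((x - 2 * g)\<^sup>2 * (x + 2) / (4 * (1 + g) * (1 - g))) / (1 + x + C * x\<^sup>2) \<ge> 0"
        using \<open>x < -2\<close> g quadratic_pos[OF C4, of x]
        by (intro divide_nonneg_pos mult_nonpos_nonpos mult_nonneg_nonpos divide_nonpos_pos) auto
      then show "\<exists>y. (log_gap C ?B ?r has_real_derivative y) (at x) \<and> 0 \<le> y"
        using log_gap_deriv[OF C4, of ?B ?r x] unfolding p by blast
    qed
    then show ?thesis using endp by simp
  qed
  show "exp (3 * g) \<le> 1 + a * y + C * a\<^sup>2 * y\<^sup>2" if y: "\<bar>y\<bar> \<ge> 1" for y
  proof (cases "g \<le> -1/2")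
    case True
    have "exp (3 * g) \<le> (1 + g) / 2" using exp_le_half_line g True by simp
    also have "\<dots> = 1 - 1 / (4 * C)" using g by (simp add: C_def field_simps)
    also have "\<dots> \<le> 1 + a * y + C * a\<^sup>2 * y\<^sup>2"
      using quadratic_ge[of C "a*y"] C4 by (simp add: power_mult_distrib mult.assoc)
    finally show ?thesis .
  next
    case False
    have "3 * g \<le> ln (1 - a + C * a\<^sup>2)"
      using endp a0 by (simp add: log_gap_def power2_eq_square power3_eq_cube)
    then have e: "exp (3 * g) \<le> 1 - a + C * a\<^sup>2"
      using quadratic_pos[OF C4, of "-a"] by (simp add: ln_ge_iff)
    have "(3/2)\<^sup>2 \<le> 6 * (1 + g)" using False by (simp add: power2_eq_square)
    then have "3/2 \<le> a" unfolding a_def by (rule real_le_rsqrt)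
    then have "1 / (2 * C) \<le> a" using False g by (simp add: C_def)
    then have aC: "1 \<le> 2 * C * a" using C4 by (simp add: field_simps)
    have "a * (\<bar>y\<bar> - 1) \<le> C * a\<^sup>2 * (y\<^sup>2 - 1)"
    proof -
      have "a * (\<bar>y\<bar> - 1) * 1 \<le> a * (\<bar>y\<bar> - 1) * (2 * C * a)"
        using aC y a0 by (intro mult_left_mono) auto
      also have "\<dots> = C * a\<^sup>2 * ((\<bar>y\<bar> - 1) * 2)" by (simp add: power2_eq_square)
      also have "\<dots> \<le> C * a\<^sup>2 * ((\<bar>y\<bar> - 1) * (\<bar>y\<bar> + 1))"
        using y C4 by (intro mult_left_mono) auto
      also have "(\<bar>y\<bar> - 1) * (\<bar>y\<bar> + 1) = y\<^sup>2 - 1" by (simp add: algebra_simps power2_eq_square)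
      finally show ?thesis by simp
    qed
    moreover have "a * y \<ge> - a * \<bar>y\<bar>" using a0
      by (metis abs_mult abs_of_pos abs_ge_minus_self minus_le_iff mult_minus_left)
    ultimately have "- (a * y) - a \<le> C * a\<^sup>2 * (y\<^sup>2 - 1)" by (simp add: algebra_simps)
    then show ?thesis using e by (simp add: algebra_simps)
  qed
qed

text \<open>The curve of \<open>weights_tangent\<close> stops satisfying the inequality when \<open>g\<close> approaches \<open>-1\<close>, which corresponds to
large scales. At such scales the load essentially counts the observations that differ from the centre, a nearly Poisson variable, and
the best weight tends to \<open>- ln 6\<close>; the fixed value \<open>b = -9/5\<close> is close to it.\<close>

lemma weights_small_slope:
  fixes a :: real
  assumes a: "0 < a" "a \<le> 41/40"
  shows "exp (a * psi y + (-9/5) * rho y) \<le> 1 + a * y + 3/10 * a\<^sup>2 * y\<^sup>2"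
proof (rule exp_psi_rho_le)
  show "0 < a" "(1::real) < 4 * (3/10)" using a by auto
  fix t :: real assume t: "\<bar>t\<bar> \<le> a"
  let ?C = "3/10::real"
  let ?B = "(-9/5) / a\<^sup>2" let ?r = "1 / a\<^sup>2"
  show "log_gap ?C ?B ?r t \<ge> 0"
  proof (rule log_gap_nonneg[of _ a])
    fix t :: real assume t: "- a \<le> t"
    have eq: "(2* ?C - 1 - 2* ?B) + (3* ?r - ?C - 2* ?B) * t + (3* ?r - 2* ?B* ?C) * t\<^sup>2 + 3* ?r* ?C * t^3
      = (18/5 + 33/5*t + 102/25*t\<^sup>2 + 9/10*t^3 - a\<^sup>2 * (2/5 + 3/10*t)) / a\<^sup>2"
      using a by (simp add: field_simps)
    have "18/5 + 33/5*t + 102/25*t\<^sup>2 + 9/10*t^3 - a\<^sup>2 * (2/5 + 3/10*t) \<ge> 0"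
    proof -
      have t1: "t \<ge> -41/40" using t a by simp
      have "a\<^sup>2 \<le> (41/40)\<^sup>2" using a by (intro power_mono) auto
      then have "a\<^sup>2 * (2/5 + 3/10*t) \<le> (41/40)\<^sup>2 * (2/5 + 3/10*t)"
        using t1 by (intro mult_right_mono) auto
      moreover have "18/5 + 33/5*t + 102/25*t\<^sup>2 + 9/10*t^3 - (41/40)\<^sup>2 * (2/5 + 3/10*t) \<ge> 0"
      proof -
        \<comment> \<open>The polynomial has nonnegative coefficients in powers of \<open>w\<close>, so the worst case is \<open>t = -41/40\<close>.\<close>
        define w where "w = t + 41/40"
        have w: "w \<ge> 0" using t1 by (simp add: w_def)
        have t: "t = w - 41/40" by (simp add: w_def)
        have "0 \<le> w * (9/10) * (w + 131/180)\<^sup>2" using w by simp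
        then show ?thesis using w unfolding t
          by (simp add: power2_eq_square power3_eq_cube field_simps)
      qed
      ultimately show ?thesis by linarith
    qed
    then show "(2* ?C - 1 - 2* ?B) + (3* ?r - ?C - 2* ?B) * t + (3* ?r - 2* ?B* ?C) * t\<^sup>2 + 3* ?r* ?C * t^3 \<ge> 0"
      unfolding eq using a by simp
  qed (use a t in auto)
next
  fix y :: real
  have "exp (-9/5) \<le> (1/6::real)"
  proof -
    have "1 + 1/10 + (1/10)\<^sup>2/2 \<le> exp (1/10::real)"
      by (rule exp_lower_Taylor_quadratic) simp
    then have "(1 + 1/10 + (1/10)\<^sup>2/2)^18 \<le> exp (1/10::real)^18" by (intro power_mono) auto
    moreover have "(6::real) \<le> (1 + 1/10 + (1/10)\<^sup>2/2)^18" by (simp add: power2_eq_square power_divide)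
    ultimately have "6 \<le> exp (9/5::real)" by (simp add: exp_of_nat_mult[symmetric])
    then show ?thesis by (simp add: exp_minus inverse_eq_divide field_simps)
  qed
  then show "exp (-9/5) \<le> 1 + a * y + 3/10 * a\<^sup>2 * y\<^sup>2"
    using quadratic_ge[of "3/10" "a*y"] by (simp add: power_mult_distrib mult.assoc)
qed

text \<open>For every scale that is not very small there are weights that turn a deviation of
\<open>sqrt 2 u\<close> with load \<open>L/3\<close> into an exponent of at least \<open>L\<close>. At large scales \<open>b \<le> 0\<close>, so an upper
bound on the load is enough.\<close>

lemma chernoff_weights:
  fixes \<beta> :: real
  assumes "1/25 \<le> \<beta>"
  shows "\<exists>a b c. 1/20 \<le> a * \<beta> \<and> a * \<beta> \<le> 4 \<and> \<bar>b\<bar> \<le> 3 \<and> c * \<beta>\<^sup>2 \<le> 2 \<and> c \<ge> 0 \<and>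
    1 + c * \<beta>\<^sup>2 \<le> sqrt 2 * (a * \<beta>) + b / 3 \<and> (1 \<le> \<beta> \<longrightarrow> b \<le> 0) \<and>
    (\<forall>y. exp (a * psi y + b * rho y) \<le> 1 + a * y + c * y\<^sup>2)"
proof (cases "\<beta> \<le> 23/10")
  case True
  \<comment> \<open>On the curve of \<open>weights_tangent\<close> the best scale for the parameter \<open>g\<close> is \<open>\<beta> = (1 - g) / sqrt (3 (1 + g))\<close>.\<close>
  have "\<exists>g\<ge>-4/5. g \<le> 19/20 \<and> (1 - g) - \<beta> * sqrt (3 * (1 + g)) = 0"
  proof (rule IVT2')
    have "sqrt (117/20) \<ge> (2::real)" by (rule real_le_rsqrt) simp
    then have "1/25 * 2 \<le> \<beta> * sqrt (117/20)" using assms by (intro mult_mono) auto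
    then show "1 - 19/20 - \<beta> * sqrt (3 * (1 + 19/20)) \<le> 0" by simp
    have "sqrt (3/5) \<le> (18/23::real)" by (rule real_le_lsqrt) (auto simp: power2_eq_square)
    then have "\<beta> * sqrt (3/5) \<le> 23/10 * (18/23)" using assms True by (intro mult_mono) auto
    then show "0 \<le> 1 - (-4/5) - \<beta> * sqrt (3 * (1 + (-4/5)))" by simp
  qed (auto intro!: continuous_intros)
  then obtain g where g: "-4/5 \<le> g" "g \<le> 19/20" and \<beta>: "\<beta> * sqrt (3 * (1 + g)) = 1 - g" by auto
  define a where "a = sqrt (6 * (1 + g))"
  define c where "c = 1 / (2 * (1 - g)) * a\<^sup>2"
  have "a = sqrt 2 * sqrt (3 * (1 + g))" by (simp add: a_def real_sqrt_mult[symmetric])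
  then have ab: "a * \<beta> = sqrt 2 * (1 - g)" using \<beta> by (metis mult.assoc mult.commute)
  have "c * \<beta>\<^sup>2 = 1 / (2 * (1 - g)) * (a * \<beta>)\<^sup>2" by (simp add: c_def power_mult_distrib)
  also have "\<dots> = 1 - g" using g unfolding ab power_mult_distrib by (simp add: divide_simps power2_eq_square)
  finally have cb: "c * \<beta>\<^sup>2 = 1 - g" .
  have s2: "1 \<le> sqrt (2::real)" "sqrt 2 \<le> (3/2::real)" by (simp, rule real_le_lsqrt) (auto simp: power2_eq_square)
  have sign: "g \<le> 0" if "1 \<le> \<beta>"
  proof (rule ccontr)
    assume "\<not> g \<le> 0"
    then have "sqrt (3 * (1 + g)) \<ge> 1" by simp
    with that have "1 * 1 \<le> \<beta> * sqrt (3 * (1 + g))" by (intro mult_mono) auto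
    with \<beta> \<open>\<not> g \<le> 0\<close> show False by simp
  qed
  show ?thesis
  proof (intro exI conjI)
    show "1/20 \<le> a * \<beta>" unfolding ab using s2 g mult_mono[of 1 "sqrt 2" "1/20" "1 - g"] by simp
    show "a * \<beta> \<le> 4" unfolding ab using s2 g mult_mono[of "sqrt 2" "3/2" "1 - g" "9/5"] by simp
    show "\<bar>3 * g\<bar> \<le> 3" using g by simp
    show "c * \<beta>\<^sup>2 \<le> 2" unfolding cb using g by simp
    show "0 \<le> c" unfolding c_def using g by simp
    show "1 + c * \<beta>\<^sup>2 \<le> sqrt 2 * (a * \<beta>) + 3 * g / 3" unfolding ab cb
      by (simp add: mult.assoc[symmetric])
    show "1 \<le> \<beta> \<longrightarrow> 3 * g \<le> 0" using sign by simp
    show "\<forall>y. exp (a * psi y + (3 * g) * rho y) \<le> 1 + a * y + c * y\<^sup>2"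
      unfolding c_def a_def using weights_tangent[of g] g by simp
  qed
next
  case False
  \<comment> \<open>The minimiser of \<open>c \<beta>\<^sup>2 - sqrt 2 a \<beta>\<close> for \<open>c = 3/10 a\<^sup>2\<close>.\<close>
  define a where "a = 5 * sqrt 2 / (3 * \<beta>)"
  have \<beta>: "\<beta> > 23/10" using False by simp
  have ab: "a * \<beta> = 5 * sqrt 2 / 3" using \<beta> by (simp add: a_def)
  have s2: "1 \<le> sqrt (2::real)" "sqrt 2 \<le> (14143/10000::real)" by (simp, rule real_le_lsqrt) (auto simp: power2_eq_square)
  have a: "0 < a" "a \<le> 41/40" using \<beta> s2 by (auto simp: a_def field_simps)
  have cb: "3/10 * a\<^sup>2 * \<beta>\<^sup>2 = 5/3"
    using \<beta> by (simp add: a_def power_mult_distrib power_divide field_simps)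
  show ?thesis
  proof (intro exI conjI)
    show "1/20 \<le> a * \<beta>" "a * \<beta> \<le> 4" unfolding ab using s2 by linarith+
    show "\<bar>-9/5::real\<bar> \<le> 3" "1 \<le> \<beta> \<longrightarrow> (-9/5::real) \<le> 0" by auto
    show "3/10 * a\<^sup>2 * \<beta>\<^sup>2 \<le> 2" "0 \<le> 3/10 * a\<^sup>2" unfolding cb by auto
    show "1 + 3/10 * a\<^sup>2 * \<beta>\<^sup>2 \<le> sqrt 2 * (a * \<beta>) + (-9/5) / 3" unfolding ab cb by simp
    show "\<forall>y. exp (a * psi y + (-9/5) * rho y) \<le> 1 + a * y + 3/10 * a\<^sup>2 * y\<^sup>2"
      using weights_small_slope[OF a] by simp
  qed
qed

section \<open>The estimate as a function of centre and scale\<close>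

text \<open>The left-hand side of the truncation equation, in terms of the scale \<open>s = sqrt \<alpha>\<close>.\<close>

definition load :: "nat \<Rightarrow> real \<Rightarrow> real \<Rightarrow> (nat \<Rightarrow> real) \<Rightarrow> real" where
  "load n s k x = (\<Sum>i<n. rho (s * (x i - k)))"

definition truncated_mean :: "nat \<Rightarrow> real \<Rightarrow> real \<Rightarrow> (nat \<Rightarrow> real) \<Rightarrow> real" where
  "truncated_mean n s k x = k + 1 / real n * (\<Sum>i<n. (x i - k) * (1 - rho (s * (x i - k))))"

lemma truncated_mean_psi:
  assumes "s > 0"
  shows "truncated_mean n s k x = k + (\<Sum>i<n. psi (s * (x i - k))) / (real n * s)"
  using assms by (simp add: truncated_mean_def psi_def sum_divide_distrib sum_distrib_left)

lemma load_shift: "\<bar>load n s k x - load n s k' x\<bar> \<le> 2 * real n * \<bar>s\<bar> * \<bar>k - k'\<bar>"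
proof -
  have "\<bar>load n s k x - load n s k' x\<bar> \<le> (\<Sum>i<n. \<bar>rho (s * (x i - k)) - rho (s * (x i - k'))\<bar>)"
    unfolding load_def sum_subtractf[symmetric] by (rule sum_abs)
  also have "\<dots> \<le> (\<Sum>i<n. 2 * (\<bar>s\<bar> * \<bar>k - k'\<bar>))"
  proof (rule sum_mono)
    fix i
    have "s * (x i - k) - s * (x i - k') = s * (k' - k)" by (simp add: algebra_simps)
    then show "\<bar>rho (s * (x i - k)) - rho (s * (x i - k'))\<bar> \<le> 2 * (\<bar>s\<bar> * \<bar>k - k'\<bar>)"
      using rho_lipschitz[of "s * (x i - k)" "s * (x i - k')"] by (simp add: abs_mult abs_minus_commute)
  qed
  finally show ?thesis by simp
qed

lemma truncated_mean_shift:
  assumes "s > 0" "n > 0"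
  shows "\<bar>truncated_mean n s k x - truncated_mean n s k' x\<bar> \<le> 3 * \<bar>k - k'\<bar>"
proof -
  let ?S = "\<lambda>k. \<Sum>i<n. psi (s * (x i - k))"
  have "\<bar>?S k - ?S k'\<bar> \<le> (\<Sum>i<n. \<bar>psi (s * (x i - k)) - psi (s * (x i - k'))\<bar>)"
    unfolding sum_subtractf[symmetric] by (rule sum_abs)
  also have "\<dots> \<le> (\<Sum>i<n. 2 * (s * \<bar>k - k'\<bar>))"
  proof (rule sum_mono)
    fix i
    have "s * (x i - k) - s * (x i - k') = s * (k' - k)" by (simp add: algebra_simps)
    then show "\<bar>psi (s * (x i - k)) - psi (s * (x i - k'))\<bar> \<le> 2 * (s * \<bar>k - k'\<bar>)"
      using psi_lipschitz[of "s * (x i - k)" "s * (x i - k')"] assms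
      by (simp add: abs_mult abs_minus_commute)
  qed
  finally have "\<bar>?S k - ?S k'\<bar> / (real n * s) \<le> 2 * \<bar>k - k'\<bar>"
    using assms by (simp add: field_simps)
  moreover have "truncated_mean n s k x - truncated_mean n s k' x = (k - k') + (?S k - ?S k') / (real n * s)"
    unfolding truncated_mean_psi[OF assms(1)] by (simp add: diff_divide_distrib)
  moreover have "\<bar>(?S k - ?S k') / (real n * s)\<bar> = \<bar>?S k - ?S k'\<bar> / (real n * s)"
    using assms by (simp add: abs_mult)
  ultimately show ?thesis
    using abs_triangle_ineq[of "k - k'" "(?S k - ?S k') / (real n * s)"] by (simp only: mult.commute) argo
qed

lemma load_mono: "0 \<le> s' \<Longrightarrow> s' \<le> s \<Longrightarrow> load n s' k x \<le> load n s k x"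
  unfolding load_def by (intro sum_mono rho_scale_mono)

lemma load_scale:
  assumes "0 \<le> s" "s \<le> h * s'" "h \<ge> 1"
  shows "load n s k x \<le> h\<^sup>2 * load n s' k x"
  unfolding load_def sum_distrib_left by (intro sum_mono rho_scale_le assms)

text \<open>Only observations with \<open>\<bar>x - k\<bar> \<le> 1 / s'\<close> change their truncation weight between the two scales, so
the change of the estimate is controlled by the change of the load. For \<open>s \<rightarrow> \<infinity>\<close> this compares the
untruncated regime with a finite scale.\<close>

lemma truncated_mean_scale:
  assumes s: "0 < s'" "s' \<le> s" and n: "n > 0"
  shows "\<bar>truncated_mean n s k x - truncated_mean n s' k x\<bar> \<le> (load n s k x - load n s' k x) / (real n * s')"
proof -
  let ?d = "\<lambda>i. x i - k"
  have termwise: "\<bar>?d i * (rho (s' * ?d i) - rho (s * ?d i))\<bar> \<le> (rho (s * ?d i) - rho (s' * ?d i)) / s'" for i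
  proof (cases "\<bar>s' * ?d i\<bar> \<le> 1")
    case True
    then have "\<bar>?d i\<bar> \<le> 1 / s'" using s by (simp add: abs_mult pos_le_divide_eq mult.commute)
    then have "\<bar>?d i\<bar> * (rho (s * ?d i) - rho (s' * ?d i)) \<le> 1 / s' * (rho (s * ?d i) - rho (s' * ?d i))"
      using rho_scale_mono[of s' s "?d i"] s by (intro mult_right_mono) auto
    then show ?thesis using rho_scale_mono[of s' s "?d i"] s by (simp add: abs_mult)
  next
    case False
    then have "1 \<le> (s' * ?d i)\<^sup>2" by (metis abs_1 abs_le_square_iff less_eq_real_def not_le one_power2)
    then have "rho (s' * ?d i) = 1" by (simp add: rho_def)
    then have "rho (s * ?d i) = 1" using rho_scale_mono[of s' s "?d i"] rho_bounds(2)[of "s * ?d i"] s by simp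
    then show ?thesis using \<open>rho (s' * ?d i) = 1\<close> by simp
  qed
  have "truncated_mean n s k x - truncated_mean n s' k x = 1 / real n * (\<Sum>i<n. ?d i * (rho (s' * ?d i) - rho (s * ?d i)))"
    unfolding truncated_mean_def by (simp add: algebra_simps sum.distrib sum_subtractf)
  then have "\<bar>truncated_mean n s k x - truncated_mean n s' k x\<bar> \<le> 1 / real n * (\<Sum>i<n. \<bar>?d i * (rho (s' * ?d i) - rho (s * ?d i))\<bar>)"
    using sum_abs[of "\<lambda>i. ?d i * (rho (s' * ?d i) - rho (s * ?d i))" "{..<n}"]
    by (simp del: sum_abs add: divide_right_mono)
  also have "\<dots> \<le> 1 / real n * (\<Sum>i<n. (rho (s * ?d i) - rho (s' * ?d i)) / s')"
    by (intro mult_left_mono sum_mono termwise) auto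
  also have "\<dots> = (load n s k x - load n s' k x) / (real n * s')"
    by (simp add: load_def sum_subtractf sum_divide_distrib[symmetric])
  finally show ?thesis .
qed

lemma truncation_eq_load:
  assumes "s > 0"
  shows "truncation_eq n \<delta> x k (s\<^sup>2) \<longleftrightarrow> load n s k x = 1/3 * ln (1 / \<delta>)"
  using assms by (simp add: truncation_eq_def load_def rho_def power_mult_distrib)

lemma load_zero: "load n 0 k x = 0"
  by (simp add: load_def rho_def)

lemma continuous_load: "continuous_on A (\<lambda>s. load n s k x)"
  unfolding load_def rho_def by (intro continuous_intros)

lemma load_attains:
  assumes "0 < L" "L \<le> load n s k x" "s \<ge> 0"
  obtains t where "0 < t" "t \<le> s" "load n t k x = L"
proof -
  have "\<exists>t\<ge>0. t \<le> s \<and> load n t k x = L"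
    using assms by (intro IVT' continuous_load) (auto simp: load_zero)
  then obtain t where "t \<ge> 0" "t \<le> s" "load n t k x = L" by auto
  moreover from this assms have "t \<noteq> 0" by (auto simp: load_zero)
  ultimately show ?thesis using that[of t] by simp
qed

text \<open>The case without a solution, in which the output is \<open>\<kappa>\<close>, is merged with the other one: it is the
estimate at a scale so large that every observation different from \<open>\<kappa>\<close> has truncation weight \<open>1\<close>.\<close>

lemma main_estimator_truncated_mean:
  assumes "S \<ge> 0" "0 < \<delta>" "\<delta> < 1"
  shows "\<exists>s>0. main_estimator P n \<delta> x = truncated_mean n s (median_of_means P n \<delta> x) x \<and>
    load n s (median_of_means P n \<delta> x) x \<le> ln (1 / \<delta>) / 3 \<and>
    (s < S \<longrightarrow> load n s (median_of_means P n \<delta> x) x = ln (1 / \<delta>) / 3)"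
proof -
  define k where "k = median_of_means P n \<delta> x"
  show ?thesis
  proof (cases "\<exists>\<alpha>. truncation_eq n \<delta> x k \<alpha>")
    case True
    define \<alpha> where "\<alpha> = (SOME \<alpha>. truncation_eq n \<delta> x k \<alpha>)"
    have \<alpha>: "truncation_eq n \<delta> x k \<alpha>" unfolding \<alpha>_def using True by (rule someI_ex)
    then have s: "sqrt \<alpha> > 0" "(sqrt \<alpha>)\<^sup>2 = \<alpha>" by (auto simp: truncation_eq_def)
    have "main_estimator P n \<delta> x = truncated_mean n (sqrt \<alpha>) k x"
      using True by (simp add: main_estimator_def k_def \<alpha>_def[unfolded k_def] Let_def truncated_mean_def rho_def
        power_mult_distrib s(2)[unfolded \<alpha>_def k_def])
    moreover have "load n (sqrt \<alpha>) k x = ln (1 / \<delta>) / 3"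
      using truncation_eq_load[OF s(1), of n \<delta> x k] \<alpha> s(2) by simp
    ultimately show ?thesis using s(1) unfolding k_def by (intro exI[of _ "sqrt \<alpha>"]) auto
  next
    case False
    have small: "load n s k x < ln (1 / \<delta>) / 3" if "s > 0" for s
    proof (rule ccontr)
      assume "\<not> ?thesis"
      obtain t where "0 < t" "load n t k x = ln (1 / \<delta>) / 3"
        by (rule load_attains[of "ln (1 / \<delta>) / 3" n s k x])
          (use \<open>s > 0\<close> assms \<open>\<not> load n s k x < ln (1 / \<delta>) / 3\<close> in auto)
      then show False using False truncation_eq_load[of t n \<delta> x k] by auto
    qed
    define A where "A = insert 1 ((\<lambda>i. \<bar>x i - k\<bar>) ` {i. i < n \<and> x i \<noteq> k})"
    have A: "finite A" "A \<noteq> {}" "\<And>a. a \<in> A \<Longrightarrow> a > 0" by (auto simp: A_def)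
    \<comment> \<open>At this scale every observation other than \<open>k\<close> is truncated completely.\<close>
    define s where "s = max (S + 1) (1 / Min A)"
    have s: "s > 0" "s \<ge> S" using assms by (auto simp: s_def)
    have zero: "(x i - k) * (1 - rho (s * (x i - k))) = 0" if "i < n" for i
    proof (cases "x i = k")
      case False
      then have "\<bar>x i - k\<bar> \<in> A" using that by (auto simp: A_def)
      then have "Min A \<le> \<bar>x i - k\<bar>" using A by simp
      moreover have "Min A > 0" using A by simp
      ultimately have "1 \<le> 1 / Min A * \<bar>x i - k\<bar>" by (simp add: field_simps)
      also have "\<dots> \<le> s * \<bar>x i - k\<bar>" by (intro mult_right_mono) (auto simp: s_def)
      finally have "1 \<le> \<bar>s * (x i - k)\<bar>" using s by (simp add: abs_mult)
      then have "1 \<le> (s * (x i - k))\<^sup>2" by (metis abs_1 abs_le_square_iff one_power2)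
      then show ?thesis by (simp add: rho_def)
    qed simp
    have "main_estimator P n \<delta> x = k"
      by (simp only: main_estimator_def Let_def k_def[symmetric] if_not_P[OF False])
    moreover have "truncated_mean n s k x = k" by (simp only: truncated_mean_def, subst sum.neutral) (use zero in auto)
    ultimately show ?thesis using s small[OF s(1)] unfolding k_def by (intro exI[of _ s]) auto
  qed
qed


section \<open>A finite family of linear tests\<close>

text \<open>Transfers a deviation at the actual centre and scale to a nearby point of the grid. The deviation
assumed has an excess of \<open>sqrt 2 \<xi> u\<close>, and all the discretisation errors together use up less than that excess. The
alternative in \<open>cases\<close> distinguishes scales between two grid points from scales beyond the last one;
in the latter case only \<open>load \<le> L/3\<close> is known for the grid scale, which is why \<open>b \<le> 0\<close> is required.\<close>

lemma fine_grid_witness: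
  fixes x :: "nat \<Rightarrow> real" and n :: nat
  assumes pos: "n > 0" "L > 0" "u > 0" "0 < \<xi>" "\<xi> \<le> 1" and h: "h = \<xi>\<^sup>2 / 2000"
    and \<beta>: "1/25 \<le> \<beta>" "\<beta> \<le> 4/\<xi>"
    and w: "1/20 \<le> a * \<beta>" "a * \<beta> \<le> 4" "\<bar>b\<bar> \<le> 3" "1 + c * \<beta>\<^sup>2 \<le> sqrt 2 * (a * \<beta>) + b / 3"
    and sg: "sg = 1 \<or> sg = (-1::real)"
    and s': "s' = \<beta> * L / (real n * u)" "s' \<le> s"
    and k': "\<bar>k - k'\<bar> \<le> h * u"
    and load: "load n s k x \<le> L/3"
    and cases: "load n s k x = L/3 \<and> s \<le> (1 + h) * s' \<or> 2/\<xi> \<le> \<beta> \<and> b \<le> 0"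
    and dev: "sg * (truncated_mean n s k x - \<mu>) \<ge> sqrt 2 * (1 + \<xi>) * u"
  shows "sg * a * (\<beta> * L / u * (truncated_mean n s' k' x - \<mu>)) + b * load n s' k' x \<ge> L * (1 + c * \<beta>\<^sup>2 + \<xi>/40)"
proof -
  define R where "R = load n s' k x"
  have h0: "0 < h" "h \<le> \<xi> / 2000" "h \<le> 1"
    using pos mult_le_one[of \<xi> \<xi>] by (auto simp: h power2_eq_square)
  \<comment> \<open>The total error in the load, weighted by \<open>\<bar>b\<bar> \<le> 3\<close>; since \<open>\<beta>\<close> may be as large as \<open>4/\<xi>\<close>, the mesh has to be of order \<open>\<xi>\<^sup>2\<close>.\<close>
  have hb: "3 * h * (2 * \<beta> + 1) \<le> \<xi> / 40"
  proof -
    have "h * \<beta> \<le> h * (4/\<xi>)" using \<beta> h0 by (intro mult_left_mono) auto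
    also have "\<dots> = \<xi> / 500" using pos by (simp add: h power2_eq_square)
    finally show ?thesis using h0 pos by (simp add: algebra_simps)
  qed
  have b0: "\<beta> > 0" using \<beta> by simp
  then have s'0: "s' > 0" using pos by (simp add: s')
  have nsu: "real n * s' * u = \<beta> * L" using pos by (simp add: s')
  have R_le: "R \<le> load n s k x" unfolding R_def by (rule load_mono) (use s' s'0 in auto)
  have R_near: "L/3 - R \<le> 2/3 * h * L" if "load n s k x = L/3" "s \<le> (1 + h) * s'"
  proof -
    have "L/3 \<le> (1 + h)\<^sup>2 * R"
      using load_scale[of s "1 + h" s' n k x] that s' s'0 h0 by (simp add: R_def)
    moreover have "(1 - 2 * h) * (1 + h)\<^sup>2 \<le> 1"
    proof -
      have "(1 - 2 * h) * (1 + h)\<^sup>2 = 1 - h\<^sup>2 * (3 + 2 * h)" by (simp add: power2_eq_square algebra_simps)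
      then show ?thesis using h0 by simp
    qed
    moreover have "R \<ge> 0" unfolding R_def load_def by (intro sum_nonneg) (simp add: rho_bounds)
    ultimately have "(1 - 2 * h) * (L/3) \<le> (1 - 2*h) * ((1 + h)\<^sup>2 * R)"
      using h0 pos by (intro mult_left_mono) auto
    also have "\<dots> \<le> 1 * R" unfolding mult.assoc[symmetric]
      using \<open>(1 - 2 * h) * (1 + h)\<^sup>2 \<le> 1\<close> \<open>R \<ge> 0\<close> by (intro mult_right_mono) auto
    finally show ?thesis by (simp add: algebra_simps)
  qed
  \<comment> \<open>Between two grid scales the loads are close; beyond the last one they need not be, but there a load of \<open>L/3\<close> moves the estimate by at most \<open>\<xi> u / 6\<close>.\<close>
  have gap: "load n s k x - R \<le> (\<xi> / 6 + 25 * h) * (\<beta> * L)"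
  proof -
    have bL: "0 < \<beta> * L" using b0 pos by simp
    from cases show ?thesis
    proof
      assume c: "load n s k x = L/3 \<and> s \<le> (1 + h) * s'"
      then have "load n s k x - R \<le> h * L"
        using R_near mult_pos_pos[OF h0(1) pos(2)] by simp
      also have "\<dots> \<le> 25 * h * (\<beta> * L)"
      proof -
        have "h * L * 1 \<le> h * L * (25 * \<beta>)" using \<beta> h0 pos by (intro mult_left_mono) auto
        then show ?thesis by (simp add: algebra_simps)
      qed
      also have "\<dots> \<le> (\<xi> / 6 + 25 * h) * (\<beta> * L)" using pos bL by (intro mult_right_mono) auto
      finally show ?thesis .
    next
      assume c: "2/\<xi> \<le> \<beta> \<and> b \<le> 0"
      have "R \<ge> 0" unfolding R_def load_def by (intro sum_nonneg) (simp add: rho_bounds)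
      then have "load n s k x - R \<le> L/3" using load by simp
      also have "\<dots> \<le> \<xi> / 6 * (\<beta> * L)"
      proof -
        have "2 \<le> \<xi> * \<beta>" using c pos by (simp add: field_simps)
        then have "2 * L \<le> \<xi> * \<beta> * L" using pos by (intro mult_right_mono) auto
        then show ?thesis by simp
      qed
      also have "\<dots> \<le> (\<xi> / 6 + 25 * h) * (\<beta> * L)" using h0 bL by (intro mult_right_mono) auto
      finally show ?thesis .
    qed
  qed
  have "\<bar>truncated_mean n s k x - truncated_mean n s' k x\<bar> \<le> (load n s k x - R) / (real n * s')"
    unfolding R_def by (rule truncated_mean_scale) (use s' s'0 pos in auto)
  also have "\<dots> \<le> (\<xi> / 6 + 25 * h) * (\<beta> * L) / (real n * s')"
    using gap s'0 by (intro divide_right_mono) auto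
  also have "\<dots> = (\<xi> / 6 + 25 * h) * u" using nsu[symmetric] s'0 pos by simp
  finally have e1: "\<bar>truncated_mean n s k x - truncated_mean n s' k x\<bar> \<le> (\<xi> / 6 + 25 * h) * u" .
  have e2: "\<bar>truncated_mean n s' k x - truncated_mean n s' k' x\<bar> \<le> 3 * h * u"
    using truncated_mean_shift[of s' n k x k'] s'0 pos k' by simp
  have "sg * (truncated_mean n s' k' x - \<mu>) \<ge> sqrt 2 * (1 + \<xi>) * u - (\<xi> / 6 + 25 * h) * u - 3 * h * u"
    using sg dev e1 e2 by (elim disjE) (simp_all add: abs_le_iff)
  also have "sqrt 2 * (1 + \<xi>) * u - (\<xi> / 6 + 25 * h) * u - 3 * h * u
      = (sqrt 2 + (sqrt 2 - 1/6) * \<xi> - 28 * h) * u" by (simp add: algebra_simps)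
  finally have "sg * (truncated_mean n s' k' x - \<mu>) \<ge> (sqrt 2 + (sqrt 2 - 1/6) * \<xi> - 28 * h) * u" .
  moreover have "(sqrt 2 + (sqrt 2 - 1/6) * \<xi> - 28 * h) * u \<ge> (sqrt 2 + \<xi>) * u"
  proof -
    have "sqrt 2 \<ge> (5/4::real)" by (rule real_le_rsqrt) (simp add: power2_eq_square)
    then have "(13/12) * \<xi> \<le> (sqrt 2 - 1/6) * \<xi>" using pos by (intro mult_right_mono) auto
    then have "sqrt 2 + \<xi> \<le> sqrt 2 + (sqrt 2 - 1/6) * \<xi> - 28 * h" using h0 pos by argo
    then show ?thesis using pos by (intro mult_right_mono) auto
  qed
  ultimately have E: "sg * (truncated_mean n s' k' x - \<mu>) \<ge> (sqrt 2 + \<xi>) * u" by linarith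
  have abL: "0 < a * \<beta> * L / u" using w pos by auto
  have "sg * a * (\<beta> * L / u * (truncated_mean n s' k' x - \<mu>)) = a * \<beta> * L / u * (sg * (truncated_mean n s' k' x - \<mu>))"
    by (simp add: algebra_simps)
  also have "\<dots> \<ge> a * \<beta> * L / u * ((sqrt 2 + \<xi>) * u)" using abL E by (intro mult_left_mono) auto
  also have "a * \<beta> * L / u * ((sqrt 2 + \<xi>) * u) = L * (sqrt 2 * (a * \<beta>) + (a * \<beta>) * \<xi>)"
    using pos by (simp add: field_simps)
  finally have "sg * a * (\<beta> * L / u * (truncated_mean n s' k' x - \<mu>)) \<ge> L * (sqrt 2 * (a * \<beta>) + (a * \<beta>) * \<xi>)" .
  moreover have "L * (sqrt 2 * (a * \<beta>) + (a * \<beta>) * \<xi>) \<ge> L * (sqrt 2 * (a * \<beta>) + 1/20 * \<xi>)"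
    using w pos by (intro mult_left_mono add_left_mono mult_right_mono) auto
  ultimately have main: "sg * a * (\<beta> * L / u * (truncated_mean n s' k' x - \<mu>)) \<ge> L * (sqrt 2 * (a * \<beta>) + 1/20 * \<xi>)"
    by linarith
  have shift: "\<bar>R - load n s' k' x\<bar> \<le> 2 * \<beta> * h * L"
  proof -
    have "\<bar>R - load n s' k' x\<bar> \<le> 2 * real n * s' * \<bar>k - k'\<bar>"
      using load_shift[of n s' k x k'] s'0 by (simp add: R_def)
    also have "\<dots> \<le> 2 * real n * s' * (h * u)" using k' s'0 by (intro mult_left_mono) auto
    also have "\<dots> = 2 * h * (real n * s' * u)" by simp
    finally show ?thesis unfolding nsu by (simp add: algebra_simps)
  qed
  have "b * load n s' k' x \<ge> b * (L/3) - 3 * ((2 * \<beta> * h + h) * L)"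
    using cases
  proof
    assume c: "load n s k x = L/3 \<and> s \<le> (1 + h) * s'"
    have "\<bar>load n s' k' x - L/3\<bar> \<le> (2 * \<beta> * h + h) * L"
      using R_near c shift R_le mult_pos_pos[OF h0(1) pos(2)] by (simp add: abs_le_iff algebra_simps)
    then have "\<bar>b\<bar> * \<bar>load n s' k' x - L/3\<bar> \<le> 3 * ((2 * \<beta> * h + h) * L)"
      using w by (intro mult_mono) auto
    then have "\<bar>b * (load n s' k' x - L/3)\<bar> \<le> 3 * ((2 * \<beta> * h + h) * L)" by (simp add: abs_mult)
    then show ?thesis by (simp add: abs_le_iff algebra_simps)
  next
    assume c: "2/\<xi> \<le> \<beta> \<and> b \<le> 0"
    have "load n s' k' x - L/3 \<le> 2 * \<beta> * h * L"
      using R_le load shift by (simp add: abs_le_iff)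
    then have "b * (load n s' k' x - L/3) \<ge> b * (2 * \<beta> * h * L)"
      using c by (intro mult_left_mono_neg) auto
    moreover have "b * (2 * \<beta> * h * L) \<ge> - 3 * (2 * \<beta> * h * L)"
      using w b0 h0 pos by (intro mult_right_mono) auto
    moreover have "h * L \<ge> 0" using h0 pos by simp
    ultimately show ?thesis by (simp add: algebra_simps)
  qed
  moreover have "3 * ((2 * \<beta> * h + h) * L) \<le> \<xi>/40 * L"
  proof -
    have "3 * h * (2 * \<beta> + 1) * L \<le> \<xi>/40 * L" using hb pos by (intro mult_right_mono) auto
    then show ?thesis by (simp add: algebra_simps)
  qed
  ultimately have "sg * a * (\<beta> * L / u * (truncated_mean n s' k' x - \<mu>)) + b * load n s' k' x
      \<ge> L * (sqrt 2 * (a * \<beta>) + b / 3 + \<xi>/40)"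
    using main by (simp add: algebra_simps)
  moreover have "L * (sqrt 2 * (a * \<beta>) + b / 3 + \<xi>/40) \<ge> L * (1 + c * \<beta>\<^sup>2 + \<xi>/40)"
    using w pos by (intro mult_left_mono) auto
  ultimately show ?thesis by linarith
qed

text \<open>At a very small scale, a load of \<open>L/3\<close> is so far above its mean that the weights
\<open>a = 0\<close>, \<open>b = 5\<close>, \<open>c = exp 5 - 1\<close> at the single scale \<open>\<beta> = 1/25\<close> detect it.\<close>

lemma coarse_witness:
  fixes x :: "nat \<Rightarrow> real" and n :: nat
  assumes pos: "n > 0" "L > 0" "u > 0" "0 < \<xi>" "\<xi> \<le> 1" and h: "h = \<xi>\<^sup>2 / 2000"
    and s': "s' = 1/25 * L / (real n * u)" "0 < s" "s \<le> s'"
    and k': "\<bar>k - k'\<bar> \<le> h * u"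
    and load: "load n s k x = L/3"
  shows "5 * load n s' k' x \<ge> L * (1 + (exp 5 - 1) * (1/25)\<^sup>2 + \<xi>/40)"
proof -
  have h0: "0 < h" "h \<le> 1 / 2000" using pos by (auto simp: h power_le_one)
  have s'0: "s' > 0" using s' by linarith
  have "\<bar>load n s' k x - load n s' k' x\<bar> \<le> 2 * real n * s' * \<bar>k - k'\<bar>"
    using load_shift[of n s' k x k'] s'0 by simp
  also have "\<dots> \<le> 2 * real n * s' * (h * u)" using k' s'0 by (intro mult_left_mono) auto
  also have "\<dots> = 2/25 * (h * L)" using pos by (simp add: s')
  also have "\<dots> \<le> 2/25 * (1/2000 * L)" using h0 pos by (intro mult_left_mono mult_right_mono) auto
  finally have "load n s' k' x \<ge> load n s' k x - L / 25000" by linarith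
  moreover have "load n s' k x \<ge> L/3" using load_mono[of s s' n k x] s' load by simp
  ultimately have "5 * load n s' k' x \<ge> L * (3/2)" using pos by linarith
  moreover have "(exp 5 :: real) \<le> 243"
  proof -
    have "(exp 5 :: real) = exp 1 ^ 5" by (simp add: exp_of_nat_mult[symmetric])
    also have "\<dots> \<le> 3 ^ 5" by (intro power_mono exp_le) auto
    finally show ?thesis by simp
  qed
  then have "1 + (exp 5 - 1) * (1/25)\<^sup>2 + \<xi>/40 \<le> 3/2"
    using pos(5) by (simp add: power2_eq_square field_simps)
  then have "L * (1 + (exp 5 - 1) * (1/25)\<^sup>2 + \<xi>/40) \<le> L * (3/2)"
    using pos by (intro mult_left_mono) auto
  ultimately show ?thesis by linarith
qed

lemma exp_rho_le: "exp (0 * psi y + 5 * rho y) \<le> 1 + 0 * y + (exp 5 - 1) * y\<^sup>2"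
proof -
  have "exp ((1 - rho y) *\<^sub>R 0 + rho y *\<^sub>R (5::real)) \<le> (1 - rho y) * exp 0 + rho y * exp 5"
    using convex_onD[OF exp_convex, of "rho y" 0 5] rho_bounds[of y] by simp
  moreover have "(exp 5 - 1) * rho y \<le> (exp 5 - 1) * y\<^sup>2"
    by (intro mult_left_mono) (auto simp: rho_def)
  ultimately show ?thesis by (simp add: algebra_simps)
qed

lemma geometric_bracket:
  fixes f :: "nat \<Rightarrow> real"
  assumes "f 0 \<le> s"
  shows "\<exists>j\<le>J. f j \<le> s \<and> (j = J \<or> s < f (Suc j))"
proof (induction J)
  case 0 then show ?case using assms by auto
next
  case (Suc J)
  then obtain j where "j \<le> J" "f j \<le> s" "j = J \<or> s < f (Suc j)" by blast
  then show ?case by (cases "f (Suc J) \<le> s") (force intro: exI[of _ "Suc J"] exI[of _ j])+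
qed

text \<open>A tuple \<open>(a, b, c, \<beta>)\<close> stands for the test that compares a weighted sum of deviation and load,
at the scale \<open>\<beta> L / (n u)\<close> and at a given centre, with the threshold \<open>L (1 + c \<beta>\<^sup>2 + \<xi>/40)\<close>. The family
is adequate when every large deviation at a centre within \<open>h u\<close> of the given one triggers a test. The
family depends neither on the sample size nor on the distribution.\<close>

definition test_family :: "real \<Rightarrow> real \<Rightarrow> (real \<times> real \<times> real \<times> real) set \<Rightarrow> bool" where
  "test_family \<xi> h W \<longleftrightarrow> finite W \<and>
    (\<forall>(a, b, c, \<beta>) \<in> W. 0 < \<beta> \<and> 0 \<le> c \<and> c * \<beta>\<^sup>2 \<le> 2 \<and>
        (\<forall>y. exp (a * psi y + b * rho y) \<le> 1 + a * y + c * y\<^sup>2)) \<and>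
    (\<forall>n L u x \<mu> k k' s. n > 0 \<longrightarrow> L > 0 \<longrightarrow> u > 0 \<longrightarrow> \<bar>k - k'\<bar> \<le> h * u \<longrightarrow> s > 0 \<longrightarrow>
        load n s k x \<le> L/3 \<longrightarrow> (s < 4/\<xi> * L / (real n * u) \<longrightarrow> load n s k x = L/3) \<longrightarrow>
        \<bar>truncated_mean n s k x - \<mu>\<bar> \<ge> sqrt 2 * (1 + \<xi>) * u \<longrightarrow>
      (\<exists>(a, b, c, \<beta>) \<in> W. a * (\<beta> * L / u * (truncated_mean n (\<beta> * L / (real n * u)) k' x - \<mu>))
          + b * load n (\<beta> * L / (real n * u)) k' x \<ge> L * (1 + c * \<beta>\<^sup>2 + \<xi>/40)))"

lemma test_familyD:
  assumes "test_family \<xi> h W"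
  shows "finite W"
    and "(a, b, c, \<beta>) \<in> W \<Longrightarrow> 0 < \<beta> \<and> 0 \<le> c \<and> c * \<beta>\<^sup>2 \<le> 2 \<and>
        (\<forall>y. exp (a * psi y + b * rho y) \<le> 1 + a * y + c * y\<^sup>2)"
    and "n > 0 \<Longrightarrow> L > 0 \<Longrightarrow> u > 0 \<Longrightarrow> \<bar>k - k'\<bar> \<le> h * u \<Longrightarrow> s > 0 \<Longrightarrow>
        load n s k x \<le> L/3 \<Longrightarrow> (s < 4/\<xi> * L / (real n * u) \<longrightarrow> load n s k x = L/3) \<Longrightarrow>
        \<bar>truncated_mean n s k x - \<mu>\<bar> \<ge> sqrt 2 * (1 + \<xi>) * u \<Longrightarrow>
      (\<exists>(a, b, c, \<beta>) \<in> W. a * (\<beta> * L / u * (truncated_mean n (\<beta> * L / (real n * u)) k' x - \<mu>))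
          + b * load n (\<beta> * L / (real n * u)) k' x \<ge> L * (1 + c * \<beta>\<^sup>2 + \<xi>/40))"
proof -
  have "\<forall>(a, b, c, \<beta>) \<in> W. 0 < \<beta> \<and> 0 \<le> c \<and> c * \<beta>\<^sup>2 \<le> 2 \<and>
        (\<forall>y. exp (a * psi y + b * rho y) \<le> 1 + a * y + c * y\<^sup>2)"
    using assms unfolding test_family_def by (elim conjE)
  then show "(a, b, c, \<beta>) \<in> W \<Longrightarrow> 0 < \<beta> \<and> 0 \<le> c \<and> c * \<beta>\<^sup>2 \<le> 2 \<and>
        (\<forall>y. exp (a * psi y + b * rho y) \<le> 1 + a * y + c * y\<^sup>2)"
    by (auto dest!: bspec)
  show "finite W" using assms unfolding test_family_def by (rule conjunct1)
  assume prem: "n > 0" "L > 0" "u > 0" "\<bar>k - k'\<bar> \<le> h * u" "s > 0"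
        "load n s k x \<le> L/3" "s < 4/\<xi> * L / (real n * u) \<longrightarrow> load n s k x = L/3"
        "\<bar>truncated_mean n s k x - \<mu>\<bar> \<ge> sqrt 2 * (1 + \<xi>) * u"
  show "\<exists>(a, b, c, \<beta>) \<in> W. a * (\<beta> * L / u * (truncated_mean n (\<beta> * L / (real n * u)) k' x - \<mu>))
          + b * load n (\<beta> * L / (real n * u)) k' x \<ge> L * (1 + c * \<beta>\<^sup>2 + \<xi>/40)"
    by (rule assms[unfolded test_family_def, THEN conjunct2, THEN conjunct2,
      THEN spec[of _ n], THEN spec[of _ L], THEN spec[of _ u], THEN spec[of _ x], THEN spec[of _ \<mu>],
      THEN spec[of _ k], THEN spec[of _ k'], THEN spec[of _ s], THEN mp, THEN mp, THEN mp, THEN mp,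
      THEN mp, THEN mp, THEN mp, THEN mp]) (fact prem)+
qed

text \<open>The scales form a geometric progression from \<open>\<beta> = 1/25\<close> to the first term above \<open>2/\<xi>\<close>. The sign in the
first weight makes the tests two-sided; it is available because \<open>psi\<close> is odd and \<open>rho\<close> is even.\<close>

lemma ex_test_family:
  assumes \<xi>: "0 < \<xi>" "\<xi> \<le> 1" and h: "h = \<xi>\<^sup>2 / 2000"
  shows "\<exists>W. test_family \<xi> h W"
proof -
  define Q where "Q \<beta> a b c \<longleftrightarrow> (1/25 \<le> \<beta> \<longrightarrow>
    1/20 \<le> a * \<beta> \<and> a * \<beta> \<le> 4 \<and> \<bar>b\<bar> \<le> 3 \<and> c * \<beta>\<^sup>2 \<le> 2 \<and> c \<ge> 0 \<and>
    1 + c * \<beta>\<^sup>2 \<le> sqrt 2 * (a * \<beta>) + b / 3 \<and> (1 \<le> \<beta> \<longrightarrow> b \<le> 0) \<and>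
    (\<forall>y. exp (a * psi y + b * rho y) \<le> 1 + a * y + c * y\<^sup>2))" for \<beta> a b c :: real
  have "\<exists>a b c. Q \<beta> a b c" for \<beta>
    using chernoff_weights[of \<beta>] unfolding Q_def by blast
  then obtain A B C where "\<And>\<beta>. Q \<beta> (A \<beta>) (B \<beta>) (C \<beta>)" by metis
  then have w: "1/20 \<le> A \<beta> * \<beta> \<and> A \<beta> * \<beta> \<le> 4 \<and> \<bar>B \<beta>\<bar> \<le> 3 \<and> C \<beta> * \<beta>\<^sup>2 \<le> 2 \<and> C \<beta> \<ge> 0 \<and>
    1 + C \<beta> * \<beta>\<^sup>2 \<le> sqrt 2 * (A \<beta> * \<beta>) + B \<beta> / 3 \<and> (1 \<le> \<beta> \<longrightarrow> B \<beta> \<le> 0) \<and>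
    (\<forall>y. exp (A \<beta> * psi y + B \<beta> * rho y) \<le> 1 + A \<beta> * y + C \<beta> * y\<^sup>2)"
    if "1/25 \<le> \<beta>" for \<beta>
    using that unfolding Q_def by blast
  have h0: "0 < h" "h \<le> 1" using \<xi> by (auto simp: h power_le_one intro: order_trans[of _ 1])
  define g where "g j = 1/25 * (1 + h) ^ j" for j
  have g: "g 0 = 1/25" "g (Suc j) = (1 + h) * g j" "1/25 \<le> g j" for j
    using h0 by (auto simp: g_def)
  obtain J0 where "2/\<xi> * 25 < (1 + h) ^ J0" using real_arch_pow[of "1 + h"] h0 by auto
  then have "2/\<xi> \<le> g J0" by (simp add: g_def)
  define J where "J = (LEAST j. 2/\<xi> \<le> g j)"
  have J: "2/\<xi> \<le> g J" unfolding J_def by (rule LeastI[of _ J0]) fact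
  have below: "g j < 2/\<xi>" if "j < J" for j using not_less_Least[of j "\<lambda>j. 2/\<xi> \<le> g j"] that by (simp add: J_def)
  have g_le: "g j \<le> 4/\<xi>" if "j \<le> J" for j
  proof (cases j)
    case 0 then show ?thesis using \<xi> by (simp add: g(1) field_simps)
  next
    case (Suc i)
    then have "g i < 2/\<xi>" using below that by simp
    then have "(1 + h) * g i \<le> 2 * (2/\<xi>)" using h0 g(3)[of i] by (intro mult_mono) auto
    then show ?thesis using Suc g(2) by simp
  qed
  define W where "W = insert (0, 5, exp 5 - 1, 1/25)
    ((\<lambda>(sg, j). (sg * A (g j), B (g j), C (g j), g j)) ` ({1, -1} \<times> {..J}))"
  show ?thesis
    unfolding test_family_def
  proof (intro exI[of _ W] conjI)
    show "finite W" by (simp add: W_def)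
    show "\<forall>(a, b, c, \<beta>) \<in> W. 0 < \<beta> \<and> 0 \<le> c \<and> c * \<beta>\<^sup>2 \<le> 2 \<and>
        (\<forall>y. exp (a * psi y + b * rho y) \<le> 1 + a * y + c * y\<^sup>2)"
    proof -
      have ineq: "exp (sg * A (g j) * psi y + B (g j) * rho y) \<le> 1 + sg * A (g j) * y + C (g j) * y\<^sup>2"
        if "sg \<in> {1, -1}" for sg j y
      proof -
        have "exp (A (g j) * psi z + B (g j) * rho z) \<le> 1 + A (g j) * z + C (g j) * z\<^sup>2" for z
          using w[OF g(3), of j] by blast
        from this[of y] this[of "-y"] that show ?thesis by (auto simp: psi_minus)
      qed
      have e5: "(exp 5 - 1) * (1/25)\<^sup>2 \<le> (2::real)" "(1::real) \<le> exp 5"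
      proof -
        have "(exp 5 :: real) = exp 1 ^ 5" by (simp add: exp_of_nat_mult[symmetric])
        also have "\<dots> \<le> 3 ^ 5" by (intro power_mono exp_le) auto
        finally show "(exp 5 - 1) * (1/25)\<^sup>2 \<le> (2::real)" by (simp add: power2_eq_square)
      qed simp
      have gp: "0 < g j" for j using g(3)[of j] by linarith
      have "0 < \<beta> \<and> 0 \<le> c \<and> c * \<beta>\<^sup>2 \<le> 2 \<and> (\<forall>y. exp (a * psi y + b * rho y) \<le> 1 + a * y + c * y\<^sup>2)"
        if mem: "(a, b, c, \<beta>) \<in> W" for a b c \<beta>
      proof -
        from mem consider "a = 0" "b = 5" "c = exp 5 - 1" "\<beta> = 1/25"
          | sg j where "sg \<in> {1, -1}" "a = sg * A (g j)" "b = B (g j)" "c = C (g j)" "\<beta> = g j"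
          by (auto simp: W_def)
        then show ?thesis
        proof cases
          case 1
          show ?thesis unfolding 1 using e5 exp_rho_le by simp
        next
          case 2
          show ?thesis unfolding 2(2-) using w[OF g(3), of j] ineq[OF 2(1)] gp by blast
        qed
      qed
      then show ?thesis by auto
    qed
    show "\<forall>n L u x \<mu> k k' s. n > 0 \<longrightarrow> L > 0 \<longrightarrow> u > 0 \<longrightarrow> \<bar>k - k'\<bar> \<le> h * u \<longrightarrow> s > 0 \<longrightarrow>
        load n s k x \<le> L/3 \<longrightarrow> (s < 4/\<xi> * L / (real n * u) \<longrightarrow> load n s k x = L/3) \<longrightarrow>
        \<bar>truncated_mean n s k x - \<mu>\<bar> \<ge> sqrt 2 * (1 + \<xi>) * u \<longrightarrow>
      (\<exists>(a, b, c, \<beta>) \<in> W. a * (\<beta> * L / u * (truncated_mean n (\<beta> * L / (real n * u)) k' x - \<mu>))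
          + b * load n (\<beta> * L / (real n * u)) k' x \<ge> L * (1 + c * \<beta>\<^sup>2 + \<xi>/40))"
    proof (intro allI impI)
      fix n :: nat and L u \<mu> k k' s :: real and x :: "nat \<Rightarrow> real"
      assume pos: "n > 0" "L > 0" "u > 0" and k': "\<bar>k - k'\<bar> \<le> h * u" and s: "s > 0"
        and load: "load n s k x \<le> L/3"
        and eq: "s < 4/\<xi> * L / (real n * u) \<longrightarrow> load n s k x = L/3"
        and dev: "\<bar>truncated_mean n s k x - \<mu>\<bar> \<ge> sqrt 2 * (1 + \<xi>) * u"
      define f where "f j = g j * L / (real n * u)" for j
      have unit: "L / (real n * u) > 0" using pos by simp
      have f_le: "f j \<le> 4/\<xi> * L / (real n * u)" if "j \<le> J" for j
        unfolding f_def using mult_right_mono[OF g_le[OF that] less_imp_le[OF unit]] by simp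
      show "\<exists>(a, b, c, \<beta>) \<in> W. a * (\<beta> * L / u * (truncated_mean n (\<beta> * L / (real n * u)) k' x - \<mu>))
          + b * load n (\<beta> * L / (real n * u)) k' x \<ge> L * (1 + c * \<beta>\<^sup>2 + \<xi>/40)"
      proof (cases "f 0 \<le> s")
        case False
        then have eqs: "load n s k x = L/3" using eq f_le[of 0] by simp
        have "s \<le> 1/25 * L / (real n * u)" using False by (simp add: f_def g(1))
        from coarse_witness[OF pos \<xi> h refl s this k' eqs]
        show ?thesis by (intro bexI[of _ "(0, 5, exp 5 - 1, 1/25)"]) (auto simp: W_def)
      next
        case True
        then obtain j where j: "j \<le> J" "f j \<le> s" "j = J \<or> s < f (Suc j)"
          using geometric_bracket[of f s J] by blast
        define sg :: real where "sg = (if truncated_mean n s k x \<ge> \<mu> then 1 else -1)"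
        have sg: "sg = 1 \<or> sg = -1" "sg \<in> {1, -1}" by (auto simp: sg_def)
        have dev': "sg * (truncated_mean n s k x - \<mu>) \<ge> sqrt 2 * (1 + \<xi>) * u" using dev by (auto simp: sg_def)
        have cases: "load n s k x = L/3 \<and> s \<le> (1 + h) * f j \<or> 2/\<xi> \<le> g j \<and> B (g j) \<le> 0"
        proof (cases "j = J")
          case True
          moreover have "1 \<le> 2/\<xi>" using \<xi> by simp
          ultimately show ?thesis using J w[OF g(3), of J] by auto
        next
          case False
          then have "s < f (Suc j)" "Suc j \<le> J" using j by auto
          moreover have "f (Suc j) = (1 + h) * f j" by (simp add: f_def g(2))
          ultimately show ?thesis using eq f_le[of "Suc j"] by auto
        qed
        have "sg * A (g j) * (g j * L / u * (truncated_mean n (f j) k' x - \<mu>)) + B (g j) * load n (f j) k' x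
            \<ge> L * (1 + C (g j) * (g j)\<^sup>2 + \<xi>/40)"
          using w[OF g(3), of j]
          by (intro fine_grid_witness[OF pos \<xi> h g(3) g_le[OF j(1)] _ _ _ _ sg(1) _ j(2) k' load cases dev'])
            (auto simp: f_def)
        then show ?thesis using j(1) sg(2)
          by (intro bexI[of _ "(sg * A (g j), B (g j), C (g j), g j)"])
            (auto simp: W_def f_def intro!: image_eqI[of _ _ "(sg, j)"])
      qed
    qed
  qed
qed

section \<open>Medians of mostly close values\<close>

lemma sorted_nth_far_right:
  assumes "sorted ys" "i < length ys" "ys ! i > m + (r::real)"
  shows "length ys - i \<le> length (filter (\<lambda>y. \<bar>y - m\<bar> > r) ys)"
proof -
  have "{i..<length ys} \<subseteq> {j. j < length ys \<and> \<bar>ys ! j - m\<bar> > r}"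
    using assms sorted_nth_mono[OF assms(1), of i] by fastforce
  then have "card {i..<length ys} \<le> card {j. j < length ys \<and> \<bar>ys ! j - m\<bar> > r}"
    by (intro card_mono) auto
  then show ?thesis by (simp add: length_filter_conv_card)
qed

lemma sorted_nth_far_left:
  assumes "sorted ys" "i < length ys" "ys ! i < m - (r::real)"
  shows "i + 1 \<le> length (filter (\<lambda>y. \<bar>y - m\<bar> > r) ys)"
proof -
  have "{..i} \<subseteq> {j. j < length ys \<and> \<bar>ys ! j - m\<bar> > r}"
    using assms sorted_nth_mono[OF assms(1), of _ i] by fastforce
  then have "card {..i} \<le> card {j. j < length ys \<and> \<bar>ys ! j - m\<bar> > r}"
    by (intro card_mono) auto
  then show ?thesis by (simp add: length_filter_conv_card)
qed

text \<open>Whichever middle value is far from \<open>m\<close>, all the values on one side of it are at least as far.\<close>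

lemma median_far_imp_half_far:
  assumes "xs \<noteq> []" and far: "\<bar>median xs - m\<bar> > r"
  shows "length xs \<le> 2 * length (filter (\<lambda>y. \<bar>y - m\<bar> > r) xs)"
proof (rule ccontr)
  define ys where "ys = sort xs"
  define k where "k = length xs"
  define b where "b = length (filter (\<lambda>y. \<bar>y - m\<bar> > r) ys)"
  have len: "length ys = k" "sorted ys" "k > 0" using assms by (auto simp: ys_def k_def)
  have "b = length (filter (\<lambda>y. \<bar>y - m\<bar> > r) xs)"
    unfolding b_def ys_def by (metis filter_sort length_sort)
  moreover assume "\<not> ?thesis"
  ultimately have b: "2 * b < k" by (simp add: k_def)
  have mid: "\<bar>ys ! i - m\<bar> \<le> r" if "k \<le> 2 * (i + 1)" "2 * i \<le> k" "i < k" for i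
  proof (rule ccontr)
    assume "\<not> ?thesis"
    then consider "ys ! i > m + r" | "ys ! i < m - r" by linarith
    then show False
    proof cases
      case 1
      from sorted_nth_far_right[OF len(2) _ 1] that b len show False by (simp add: b_def)
    next
      case 2
      from sorted_nth_far_left[OF len(2) _ 2] that b len show False by (simp add: b_def)
    qed
  qed
  have "\<bar>median xs - m\<bar> \<le> r"
  proof (cases "odd k")
    case True
    then have "median xs = ys ! (k div 2)" by (simp add: median_def Let_def ys_def k_def)
    then show ?thesis using mid[of "k div 2"] len True by simp
  next
    case False
    then have "median xs = (ys ! (k div 2 - 1) + ys ! (k div 2)) / 2"
      by (simp add: median_def Let_def ys_def k_def)
    moreover have "k div 2 \<ge> 1" using False len by presburger
    ultimately show ?thesis using mid[of "k div 2"] mid[of "k div 2 - 1"] len False by (auto simp: abs_le_iff)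
  qed
  then show False using far by simp
qed

section \<open>Measurability of the estimator\<close>

text \<open>Expresses an order statistic by a count, which is a measurable function of the unsorted values.\<close>

lemma sorted_nth_le_iff:
  fixes ys :: "real list"
  assumes "sorted ys" "i < length ys"
  shows "ys ! i \<le> t \<longleftrightarrow> i < card {j. j < length ys \<and> ys ! j \<le> t}"
proof
  assume le: "ys ! i \<le> t"
  have "{..i} \<subseteq> {j. j < length ys \<and> ys ! j \<le> t}"
    using assms le sorted_nth_mono[OF assms(1), of _ i] by fastforce
  then have "card {..i} \<le> card {j. j < length ys \<and> ys ! j \<le> t}" by (intro card_mono) auto
  then show "i < card {j. j < length ys \<and> ys ! j \<le> t}" by simp
next
  assume card: "i < card {j. j < length ys \<and> ys ! j \<le> t}"
  show "ys ! i \<le> t"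
  proof (rule ccontr)
    assume "\<not> ?thesis"
    have "{j. j < length ys \<and> ys ! j \<le> t} \<subseteq> {..<i}"
    proof
      fix j assume j: "j \<in> {j. j < length ys \<and> ys ! j \<le> t}"
      show "j \<in> {..<i}"
      proof (rule ccontr)
        assume "j \<notin> {..<i}"
        then have "ys ! i \<le> ys ! j" using j assms by (intro sorted_nth_mono) auto
        with j \<open>\<not> ys ! i \<le> t\<close> show False by simp
      qed
    qed
    then have "card {j. j < length ys \<and> ys ! j \<le> t} \<le> card {..<i}" by (intro card_mono) auto
    with card show False by simp
  qed
qed

lemma borel_measurable_sort_nth:
  fixes g :: "nat \<Rightarrow> 'a \<Rightarrow> real"
  assumes g: "\<And>j. j < k \<Longrightarrow> g j \<in> borel_measurable M" and "i < k"
  shows "(\<lambda>X. sort (map (\<lambda>j. g j X) [0..<k]) ! i) \<in> borel_measurable M"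
  unfolding borel_measurable_iff_le
proof
  fix t
  have iff: "sort (map (\<lambda>j. g j X) [0..<k]) ! i \<le> t \<longleftrightarrow> real i < (\<Sum>j<k. if g j X \<le> t then 1 else 0)" for X
  proof -
    let ?xs = "map (\<lambda>j. g j X) [0..<k]"
    have "card {j. j < length (sort ?xs) \<and> sort ?xs ! j \<le> t} = length (filter (\<lambda>y. y \<le> t) (sort ?xs))"
      by (simp add: length_filter_conv_card)
    also have "\<dots> = length (filter (\<lambda>y. y \<le> t) ?xs)" by (metis filter_sort length_sort)
    also have "\<dots> = card {j. j < k \<and> g j X \<le> t}"
      by (simp add: length_filter_conv_card cong: conj_cong)
    also have "real \<dots> = (\<Sum>j<k. if g j X \<le> t then 1 else 0)"
      by (subst sum.If_cases) (auto simp: Int_def)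
    finally show ?thesis using sorted_nth_le_iff[of "sort ?xs" i t] assms(2) by simp linarith
  qed
  have [measurable]: "(\<lambda>X. \<Sum>j<k. if g j X \<le> t then 1 else 0 :: real) \<in> borel_measurable M"
  proof (intro borel_measurable_sum)
    fix j assume "j \<in> {..<k}"
    then have [measurable]: "g j \<in> borel_measurable M" using g by simp
    show "(\<lambda>X. if g j X \<le> t then 1 else 0 :: real) \<in> borel_measurable M" by measurable
  qed
  show "{X \<in> space M. sort (map (\<lambda>j. g j X) [0..<k]) ! i \<le> t} \<in> sets M"
    unfolding iff by measurable
qed

lemma borel_measurable_median:
  fixes g :: "nat \<Rightarrow> 'a \<Rightarrow> real"
  assumes g: "\<And>j. j < k \<Longrightarrow> g j \<in> borel_measurable M" and "k > 0"
  shows "(\<lambda>X. median (map (\<lambda>j. g j X) [0..<k])) \<in> borel_measurable M"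
proof (cases "odd k")
  case True
  then show ?thesis
    unfolding median_def Let_def using borel_measurable_sort_nth[OF g, where i = "k div 2"] \<open>k > 0\<close> by simp
next
  case False
  then show ?thesis
    unfolding median_def Let_def using borel_measurable_sort_nth[OF g] \<open>k > 0\<close>
    by (auto intro!: borel_measurable_divide borel_measurable_add)
qed

text \<open>The output is the same for all solutions of the truncation equation: equal loads force equal
estimates by \<open>truncated_mean_scale\<close>. This removes the arbitrary choice of a solution.\<close>

lemma main_estimator_eq_truncated_mean:
  assumes "n > 0" "s > 0" and eq: "load n s (median_of_means P n \<delta> x) x = 1/3 * ln (1 / \<delta>)"
  shows "main_estimator P n \<delta> x = truncated_mean n s (median_of_means P n \<delta> x) x"
proof -
  define k where "k = median_of_means P n \<delta> x"
  define \<alpha> where "\<alpha> = (SOME \<alpha>. truncation_eq n \<delta> x k \<alpha>)"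
  have ex: "\<exists>\<alpha>. truncation_eq n \<delta> x k \<alpha>"
    using truncation_eq_load[OF assms(2), of n \<delta> x k] eq by (auto simp: k_def)
  have \<alpha>: "truncation_eq n \<delta> x k \<alpha>" unfolding \<alpha>_def using ex by (rule someI_ex)
  then have s': "sqrt \<alpha> > 0" "(sqrt \<alpha>)\<^sup>2 = \<alpha>" by (auto simp: truncation_eq_def)
  have load': "load n (sqrt \<alpha>) k x = 1/3 * ln (1 / \<delta>)"
    using truncation_eq_load[OF s'(1), of n \<delta> x k] \<alpha> s'(2) by simp
  have "main_estimator P n \<delta> x =
      k + 1 / real n * (\<Sum>i<n. (x i - k) * (1 - min (\<alpha> * (x i - k)\<^sup>2) 1))"
    using ex by (simp only: main_estimator_def Let_def k_def[symmetric] \<alpha>_def if_True)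
  also have "\<dots> = truncated_mean n (sqrt \<alpha>) k x"
    by (simp only: truncated_mean_def rho_def power_mult_distrib s'(2))
  also have "\<dots> = truncated_mean n s k x"
  proof -
    have same: "load n (sqrt \<alpha>) k x = load n s k x" using load' eq by (simp add: k_def)
    show ?thesis
      using truncated_mean_scale[of "sqrt \<alpha>" s n k x] truncated_mean_scale[of s "sqrt \<alpha>" n k x] s'(1) assms(1,2)
      by (cases "s \<le> sqrt \<alpha>") (auto simp: same)
  qed
  finally show ?thesis by (simp add: k_def)
qed

text \<open>The smallest scale at which the load reaches \<open>L\<close>, a measurable selection of a solution of the
truncation equation. Quantifying over natural numbers keeps the existence of a solution a countable condition.\<close>

definition first_load :: "nat \<Rightarrow> real \<Rightarrow> real \<Rightarrow> (nat \<Rightarrow> real) \<Rightarrow> real" where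
  "first_load n L k x = (if \<exists>N. load n (real N) k x \<ge> L then Inf {s. 0 \<le> s \<and> load n s k x \<ge> L} else 0)"

lemma first_load_props:
  assumes "L > 0" and ex: "\<exists>N. load n (real N) k x \<ge> L"
  shows "first_load n L k x > 0" "load n (first_load n L k x) k x = L"
    "0 \<le> t \<Longrightarrow> first_load n L k x \<le> t \<longleftrightarrow> L \<le> load n t k x"
proof -
  define A where "A = {s. 0 \<le> s \<and> load n s k x \<ge> L}"
  have bdd: "bdd_below A" by (auto simp: A_def bdd_below_def)
  have "closed ({0..} \<inter> (\<lambda>s. load n s k x) -` {L..})"
    by (intro continuous_closed_preimage continuous_load) auto
  moreover have "{0..} \<inter> (\<lambda>s. load n s k x) -` {L..} = A" by (auto simp: A_def)
  ultimately have "closed A" by simp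
  moreover have "A \<noteq> {}" using ex of_nat_0_le_iff by (fastforce simp: A_def)
  ultimately have "Inf A \<in> A" using bdd by (intro closed_contains_Inf)
  moreover have fl: "first_load n L k x = Inf A" using ex by (simp add: first_load_def A_def)
  ultimately have in_A: "first_load n L k x \<ge> 0" "load n (first_load n L k x) k x \<ge> L"
    by (auto simp: A_def)
  have least: "first_load n L k x \<le> s" if "0 \<le> s" "L \<le> load n s k x" for s
    unfolding fl using that bdd by (intro cInf_lower) (auto simp: A_def)
  obtain t where t: "0 < t" "t \<le> first_load n L k x" "load n t k x = L"
    using load_attains[OF assms(1) in_A(2) in_A(1)] .
  then have "first_load n L k x = t" using least[of t] by simp
  then show "first_load n L k x > 0" "load n (first_load n L k x) k x = L" using t by auto
  show "first_load n L k x \<le> t \<longleftrightarrow> L \<le> load n t k x" if "0 \<le> t" for t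
    using least[of t] in_A load_mono[of "first_load n L k x" t n k x] that by auto
qed

lemma main_estimator_first_load:
  assumes "n > 0" "0 < \<delta>" "\<delta> < 1"
  shows "main_estimator P n \<delta> x = (let k = median_of_means P n \<delta> x; L = 1/3 * ln (1 / \<delta>) in
     if \<exists>N. load n (real N) k x \<ge> L then truncated_mean n (first_load n L k x) k x else k)"
proof -
  define k where "k = median_of_means P n \<delta> x"
  define L where "L = 1/3 * ln (1 / \<delta>)"
  have L: "L > 0" using assms by (simp add: L_def)
  show ?thesis
  proof (cases "\<exists>N. load n (real N) k x \<ge> L")
    case True
    have "main_estimator P n \<delta> x = truncated_mean n (first_load n L k x) k x"
      unfolding k_def by (rule main_estimator_eq_truncated_mean[OF assms(1)])
        (use first_load_props[OF L True] in \<open>simp_all only: k_def[symmetric] L_def[symmetric]\<close>)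
    then show ?thesis by (simp only: k_def[symmetric] Let_def L_def[symmetric] True if_True)
  next
    case False
    have "\<nexists>\<alpha>. truncation_eq n \<delta> x k \<alpha>"
    proof
      assume "\<exists>\<alpha>. truncation_eq n \<delta> x k \<alpha>"
      then obtain \<alpha> where \<alpha>: "truncation_eq n \<delta> x k \<alpha>" ..
      then have "sqrt \<alpha> > 0" "(sqrt \<alpha>)\<^sup>2 = \<alpha>" by (auto simp: truncation_eq_def)
      with \<alpha> truncation_eq_load[of "sqrt \<alpha>" n \<delta> x k] have "load n (sqrt \<alpha>) k x = L"
        by (simp add: L_def)
      moreover obtain N where "sqrt \<alpha> \<le> real N" using real_arch_simple by blast
      ultimately have "load n (real N) k x \<ge> L"
        using load_mono[of "sqrt \<alpha>" "real N" n k x] \<open>sqrt \<alpha> > 0\<close> by simp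
      with False show False by blast
    qed
    then have "main_estimator P n \<delta> x = k"
      by (simp only: main_estimator_def Let_def k_def[symmetric] if_False)
    then show ?thesis by (simp only: k_def[symmetric] Let_def L_def[symmetric] False if_False)
  qed
qed

lemma borel_measurable_median_of_means:
  assumes "balanced_partition n (num_groups \<delta>) (P n \<delta>)" "num_groups \<delta> > 0"
  shows "median_of_means P n \<delta> \<in> borel_measurable (PiM {..<n} (\<lambda>_. borel))"
  unfolding median_of_means_def[abs_def]
proof (rule borel_measurable_median[OF _ assms(2)])
  fix j assume "j < num_groups \<delta>"
  then have "P n \<delta> j \<subseteq> {..<n}" using assms(1) by (auto simp: balanced_partition_def)
  then show "(\<lambda>x. (\<Sum>i\<in>P n \<delta> j. x i) / real (card (P n \<delta> j))) \<in> borel_measurable (PiM {..<n} (\<lambda>_. borel))"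
    by (intro borel_measurable_divide borel_measurable_sum borel_measurable_const
        measurable_component_singleton) auto
qed

lemma borel_measurable_load:
  assumes [measurable]: "s \<in> borel_measurable (PiM {..<n} (\<lambda>_. borel))" "k \<in> borel_measurable (PiM {..<n} (\<lambda>_. borel))"
  shows "(\<lambda>x. load n (s x) (k x) x) \<in> borel_measurable (PiM {..<n} (\<lambda>_. borel))"
  unfolding load_def rho_def by measurable

lemma borel_measurable_truncated_mean:
  assumes [measurable]: "s \<in> borel_measurable (PiM {..<n} (\<lambda>_. borel))" "k \<in> borel_measurable (PiM {..<n} (\<lambda>_. borel))"
  shows "(\<lambda>x. truncated_mean n (s x) (k x) x) \<in> borel_measurable (PiM {..<n} (\<lambda>_. borel))"
  unfolding truncated_mean_def rho_def by measurable

lemma borel_measurable_main_estimator: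
  assumes "balanced_partition n (num_groups \<delta>) (P n \<delta>)" "num_groups \<delta> > 0"
    and \<delta>: "n > 0" "0 < \<delta>" "\<delta> < 1"
  shows "main_estimator P n \<delta> \<in> borel_measurable (PiM {..<n} (\<lambda>_. borel))"
proof -
  let ?M = "PiM {..<n} (\<lambda>_. borel :: real measure)"
  define k where "k = median_of_means P n \<delta>"
  define L where "L = 1/3 * ln (1 / \<delta>)"
  have L: "L > 0" using assms by (simp add: L_def)
  have k [measurable]: "k \<in> borel_measurable ?M"
    unfolding k_def using assms(1,2) by (rule borel_measurable_median_of_means)
  have [measurable]: "(\<lambda>x. load n t (k x) x) \<in> borel_measurable ?M" for t
    by (rule borel_measurable_load) auto
  have [measurable]: "(\<lambda>x. first_load n L (k x) x) \<in> borel_measurable ?M"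
    unfolding borel_measurable_iff_le
  proof
    fix t
    have "first_load n L (k x) x \<le> t \<longleftrightarrow>
      0 \<le> t \<and> ((\<exists>N. load n (real N) (k x) x \<ge> L) \<longrightarrow> L \<le> load n t (k x) x)" for x
    proof (cases "\<exists>N. load n (real N) (k x) x \<ge> L")
      case True
      show ?thesis using first_load_props(1)[OF L True] first_load_props(3)[OF L True, of t] True by force
    next
      case False
      then show ?thesis by (simp add: first_load_def)
    qed
    then show "{x \<in> space ?M. first_load n L (k x) x \<le> t} \<in> sets ?M"
      by (simp only:) measurable
  qed
  have "main_estimator P n \<delta> = (\<lambda>x. if \<exists>N. load n (real N) (k x) x \<ge> L
      then truncated_mean n (first_load n L (k x) x) (k x) x else k x)"
    by (rule ext, subst main_estimator_first_load[OF \<delta>]) (simp add: Let_def k_def L_def)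
  moreover have [measurable]: "(\<lambda>x. truncated_mean n (first_load n L (k x) x) (k x) x) \<in> borel_measurable ?M"
    by (rule borel_measurable_truncated_mean) auto
  ultimately show ?thesis by simp
qed

section \<open>Concentration for independent samples\<close>

locale square_integrable_distribution = real_distribution D for D :: "real measure" +
  assumes square_integrable: "integrable D (\<lambda>x. x\<^sup>2)"
begin

sublocale iid: product_sigma_finite "\<lambda>_::nat. D"
  by standard

abbreviation "\<mu> \<equiv> mean D"
abbreviation "\<sigma> \<equiv> std_dev D"

lemma sets_iid: "sets (iid n D) = sets (PiM {..<n} (\<lambda>_. borel))"
  by (intro sets_PiM_cong) simp_all

lemma prob_space_iid: "prob_space (iid n D)"
  by (intro prob_space_PiM) (rule prob_space_axioms)

lemma integrable_id: "integrable D (\<lambda>x. x)"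
  by (rule square_integrable_imp_integrable) (use square_integrable in auto)

lemma std_dev_square: "\<sigma>\<^sup>2 = (\<integral>x. (x - \<mu>)\<^sup>2 \<partial>D)"
  unfolding std_dev_def mean_def by (simp add: integral_nonneg_AE)

lemma std_dev_nonneg: "\<sigma> \<ge> 0"
  by (simp add: std_dev_def integral_nonneg_AE)

lemma integrable_square_shift: "integrable D (\<lambda>x. (x - k)\<^sup>2)"
  unfolding power2_diff using square_integrable integrable_id by auto

lemma second_moment: "(\<integral>x. (x - k)\<^sup>2 \<partial>D) = \<sigma>\<^sup>2 + (\<mu> - k)\<^sup>2"
proof -
  have "(\<integral>x. (x - k)\<^sup>2 \<partial>D) = (\<integral>x. (x - \<mu>)\<^sup>2 + 2 * (\<mu> - k) * (x - \<mu>) + (\<mu> - k)\<^sup>2 \<partial>D)"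
    by (intro Bochner_Integration.integral_cong) (auto simp: power2_eq_square algebra_simps)
  also have "\<dots> = \<sigma>\<^sup>2 + (\<mu> - k)\<^sup>2"
    using integrable_square_shift[of \<mu>] integrable_id prob_space
    by (simp add: std_dev_square) (simp add: mean_def)
  finally show ?thesis .
qed

text \<open>The centre \<open>k\<close> is not the mean, so \<open>y = s (x - k)\<close> has mean \<open>s (\<mu> - k)\<close>. The first-order term
\<open>a n s (\<mu> - k)\<close> that this adds to the exponent is exactly the difference between
\<open>truncated_mean - k\<close> and \<open>truncated_mean - \<mu>\<close>; only the quadratic term \<open>(\<mu> - k)\<^sup>2\<close> survives.\<close>

lemma chernoff:
  assumes s: "s > 0" and n: "n > 0"
    and ineq: "\<And>y. exp (a * psi y + b * rho y) \<le> 1 + a * y + c * y\<^sup>2"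
  shows "measure (iid n D) {X \<in> space (iid n D). a * (real n * s * (truncated_mean n s k X - \<mu>)) + b * load n s k X \<ge> z}
    \<le> exp (- z + real n * (c * s\<^sup>2 * (\<sigma>\<^sup>2 + (\<mu> - k)\<^sup>2)))"
proof -
  interpret N: prob_space "iid n D" by (rule prob_space_iid)
  define f where "f x = exp (a * psi (s * (x - k)) + b * rho (s * (x - k)))" for x
  define w where "w = a * (real n * s * (k - \<mu>))"
  have [measurable]: "f \<in> borel_measurable borel"
    unfolding f_def psi_def rho_def by measurable
  have int: "integrable D (\<lambda>x. 1 + a * (s * (x - k)) + c * (s * (x - k))\<^sup>2)"
    using integrable_square_shift[of k] integrable_id by (simp add: power_mult_distrib)
  have f_int: "integrable D f"
  proof (rule Bochner_Integration.integrable_bound[OF int])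
    show "AE x in D. norm (f x) \<le> norm (1 + a * (s * (x - k)) + c * (s * (x - k))\<^sup>2)"
    proof (rule AE_I2)
      fix x
      have "0 < f x" by (simp add: f_def)
      moreover have "f x \<le> 1 + a * (s * (x - k)) + c * (s * (x - k))\<^sup>2"
        unfolding f_def by (rule ineq)
      ultimately show "norm (f x) \<le> norm (1 + a * (s * (x - k)) + c * (s * (x - k))\<^sup>2)" by simp
    qed
  qed simp
  let ?e = "a * s * (\<mu> - k) + c * s\<^sup>2 * (\<sigma>\<^sup>2 + (\<mu> - k)\<^sup>2)"
  have "integral\<^sup>L D f \<le> (\<integral>x. 1 + a * (s * (x - k)) + c * (s * (x - k))\<^sup>2 \<partial>D)"
    by (intro integral_mono f_int int) (simp add: f_def ineq)
  also have "\<dots> = 1 + ?e"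
    using integrable_square_shift[of k] integrable_id second_moment[of k] prob_space
    by (simp add: power_mult_distrib) (simp add: mean_def algebra_simps)
  also have "\<dots> \<le> exp ?e" by (rule exp_ge_add_one_self)
  finally have Ef: "integral\<^sup>L D f \<le> exp ?e" .
  define U where "U X = (\<Prod>i<n. f (X i))" for X :: "nat \<Rightarrow> real"
  have U_int: "integrable (iid n D) U"
    unfolding U_def by (rule iid.product_integrable_prod) (auto simp: f_int)
  have "integral\<^sup>L (iid n D) U = (\<Prod>i<n. integral\<^sup>L D f)"
    unfolding U_def by (rule iid.product_integral_prod) (auto simp: f_int)
  also have "\<dots> = (integral\<^sup>L D f) ^ n" by simp
  also have "\<dots> \<le> exp ?e ^ n"
    by (intro power_mono Ef integral_nonneg_AE) (auto simp: f_def)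
  finally have EU: "integral\<^sup>L (iid n D) U \<le> exp (real n * ?e)" by (simp add: exp_of_nat_mult)
  have U_eq: "U X = exp (a * (real n * s * (truncated_mean n s k X - \<mu>)) + b * load n s k X - w)" for X
  proof -
    have "a * (real n * s * (truncated_mean n s k X - \<mu>)) + b * load n s k X - w
      = (\<Sum>i<n. a * psi (s * (X i - k)) + b * rho (s * (X i - k)))"
      using s n unfolding truncated_mean_psi[OF s] load_def w_def
      by (simp add: sum.distrib sum_distrib_left[symmetric] algebra_simps)
    then show ?thesis unfolding U_def f_def by (simp add: exp_sum)
  qed
  have "{X \<in> space (iid n D). a * (real n * s * (truncated_mean n s k X - \<mu>)) + b * load n s k X \<ge> z}
      = {X \<in> space (iid n D). U X \<ge> exp (z - w)}"
    unfolding U_eq by simp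
  also have "measure (iid n D) \<dots> \<le> integral\<^sup>L (iid n D) U / exp (z - w)"
    by (rule integral_Markov_inequality_measure[OF U_int sets.top]) (auto simp: U_def f_def prod_nonneg)
  also have "\<dots> \<le> exp (real n * ?e) / exp (z - w)"
    by (intro divide_right_mono EU) auto
  also have "\<dots> = exp (real n * ?e - (z - w))" by (simp add: exp_diff)
  also have "real n * ?e - (z - w) = - z + real n * (c * s\<^sup>2 * (\<sigma>\<^sup>2 + (\<mu> - k)\<^sup>2))"
    by (simp add: w_def algebra_simps)
  finally show ?thesis .
qed

lemma integral_coordinate_product:
  assumes "i < n" "j < n"
  shows "integrable (iid n D) (\<lambda>X. (X i - \<mu>) * (X j - \<mu>))"
    and "(\<integral>X. (X i - \<mu>) * (X j - \<mu>) \<partial>iid n D) = (if i = j then \<sigma>\<^sup>2 else 0)"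
proof -
  \<comment> \<open>Written as a product over all coordinates, so that the integral factorises.\<close>
  define f where "f l x = (if l = i then x - \<mu> else 1) * (if l = j then x - \<mu> else 1)" for l :: nat and x
  have f_int: "integrable D (f l)" for l
    unfolding f_def[abs_def] using integrable_square_shift[of \<mu>] integrable_id
    by (cases "l = i"; cases "l = j") (simp_all add: power2_eq_square)
  have prod: "(\<Prod>l<n. f l (X l)) = (X i - \<mu>) * (X j - \<mu>)" for X :: "nat \<Rightarrow> real"
    unfolding f_def prod.distrib using assms by simp
  show "integrable (iid n D) (\<lambda>X. (X i - \<mu>) * (X j - \<mu>))"
    using iid.product_integrable_prod[of "{..<n}" f] f_int by (simp add: prod)
  have "(\<integral>X. (X i - \<mu>) * (X j - \<mu>) \<partial>iid n D) = (\<Prod>l<n. integral\<^sup>L D (f l))"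
    using iid.product_integral_prod[of "{..<n}" f] f_int by (simp add: prod)
  also have "\<dots> = (if i = j then \<sigma>\<^sup>2 else 0)"
  proof (cases "i = j")
    case True
    have "integral\<^sup>L D (f l) = (if l = i then \<sigma>\<^sup>2 else 1)" for l
      unfolding f_def[abs_def] using True prob_space
      by (simp add: std_dev_square[symmetric] power2_eq_square[symmetric])
    then show ?thesis using True assms by simp
  next
    case False
    have "integral\<^sup>L D (f i) = 0"
      unfolding f_def[abs_def] using False integrable_id prob_space by simp (simp add: mean_def)
    then show ?thesis using False assms by (auto intro!: prod_zero)
  qed
  finally show "(\<integral>X. (X i - \<mu>) * (X j - \<mu>) \<partial>iid n D) = (if i = j then \<sigma>\<^sup>2 else 0)" .
qed

lemma chebyshev_sum:
  assumes J: "J \<subseteq> {..<n}" and r: "r > 0"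
  shows "measure (iid n D) {X \<in> space (iid n D). \<bar>\<Sum>i\<in>J. (X i - \<mu>)\<bar> \<ge> r} \<le> real (card J) * \<sigma>\<^sup>2 / r\<^sup>2"
proof -
  interpret N: prob_space "iid n D" by (rule prob_space_iid)
  have fin: "finite J" using J finite_subset by blast
  define U where "U X = (\<Sum>i\<in>J. X i - \<mu>)\<^sup>2" for X :: "nat \<Rightarrow> real"
  have U: "U X = (\<Sum>i\<in>J. \<Sum>j\<in>J. (X i - \<mu>) * (X j - \<mu>))" for X
    by (simp add: U_def power2_eq_square sum_product)
  have lt: "i < n" if "i \<in> J" for i using J that by auto
  have U_int: "integrable (iid n D) U"
    unfolding U by (intro Bochner_Integration.integrable_sum integral_coordinate_product lt)
  have "integral\<^sup>L (iid n D) U = (\<Sum>i\<in>J. \<Sum>j\<in>J. if i = j then \<sigma>\<^sup>2 else 0)"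
    unfolding U using lt
    by (simp add: integral_coordinate_product Bochner_Integration.integral_sum)
  also have "\<dots> = real (card J) * \<sigma>\<^sup>2" using fin by (simp add: sum.delta)
  finally have EU: "integral\<^sup>L (iid n D) U = real (card J) * \<sigma>\<^sup>2" .
  have "{X \<in> space (iid n D). \<bar>\<Sum>i\<in>J. (X i - \<mu>)\<bar> \<ge> r} = {X \<in> space (iid n D). U X \<ge> r\<^sup>2}"
    using r by (auto simp: U_def abs_le_square_iff[of r, symmetric])
  also have "measure (iid n D) \<dots> \<le> integral\<^sup>L (iid n D) U / r\<^sup>2"
    by (rule integral_Markov_inequality_measure[OF U_int sets.top]) (use r in \<open>auto simp: U_def\<close>)
  finally show ?thesis unfolding EU .
qed

lemma indep_coordinates:
  assumes "n > 0"
  shows "prob_space.indep_vars (iid n D) (\<lambda>_. D) (\<lambda>i X. X i) {..<n}"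
proof (subst prob_space.indep_vars_iff_distr_eq_PiM'[OF prob_space_iid])
  have "distr (iid n D) (iid n D) (\<lambda>X. restrict X {..<n}) = distr (iid n D) (iid n D) (\<lambda>X. X)"
    by (intro distr_cong) (auto simp: space_PiM PiE_restrict)
  moreover have "Pi\<^sub>M {..<n} (\<lambda>i. distr (iid n D) D (\<lambda>X. X i)) = iid n D"
    by (intro PiM_cong refl distr_PiM_component) (auto simp: prob_space_axioms)
  ultimately show "distr (iid n D) (iid n D) (\<lambda>X. \<lambda>i\<in>{..<n}. X i) =
      Pi\<^sub>M {..<n} (\<lambda>i. distr (iid n D) D (\<lambda>X. X i))" by simp
qed (use assms in auto)

lemma indep_blocks:
  assumes "n > 0" "disjoint_family_on G {..<k}" "\<And>j. j < k \<Longrightarrow> G j \<subseteq> {..<n}"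
    and "\<And>j. j < k \<Longrightarrow> f j \<in> borel_measurable (PiM (G j) (\<lambda>_. borel))"
  shows "prob_space.indep_vars (iid n D) (\<lambda>_. borel) (\<lambda>j X. f j (restrict X (G j))) {..<k}"
proof -
  interpret N: prob_space "iid n D" by (rule prob_space_iid)
  have "N.indep_vars (\<lambda>j. PiM (G j) (\<lambda>_. D)) (\<lambda>j X. restrict (\<lambda>i. X i) (G j)) {..<k}"
    by (rule N.indep_vars_restrict[OF indep_coordinates[OF assms(1)]]) (use assms in auto)
  then show ?thesis
  proof (rule N.indep_vars_compose2)
    fix j assume "j \<in> {..<k}"
    moreover have "sets (PiM (G j) (\<lambda>_. D)) = sets (PiM (G j) (\<lambda>_. borel))"
      by (intro sets_PiM_cong) auto
    ultimately show "f j \<in> measurable (PiM (G j) (\<lambda>_. D)) borel"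
      using assms(4)[of j] by (simp cong: measurable_cong_sets)
  qed
qed

text \<open>Each group mean is far from \<open>\<mu>\<close> with probability at most \<open>exp (- 6)\<close> by Chebyshev, the groups are
independent, and a far median needs half of the groups to be far. The bound follows from the exponential
moment of \<open>6\<close> times the number of far groups, which is at most \<open>exp 1\<close> per group.\<close>

lemma median_of_means_concentration:
  fixes G :: "nat \<Rightarrow> nat set"
  assumes n: "n > 0" and k: "k > 0"
    and disj: "disjoint_family_on G {..<k}" and sub: "\<And>j. j < k \<Longrightarrow> G j \<subseteq> {..<n}"
    and m: "m > 0" "\<And>j. j < k \<Longrightarrow> m \<le> real (card (G j))"
    and r: "r > 0" "\<sigma>\<^sup>2 / (m * r\<^sup>2) \<le> exp (- 6)"
  shows "measure (iid n D) {X \<in> space (iid n D).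
      \<bar>median (map (\<lambda>j. (\<Sum>i\<in>G j. X i) / real (card (G j))) [0..<k]) - \<mu>\<bar> > r} \<le> exp (- 2 * real k)"
proof -
  interpret N: prob_space "iid n D" by (rule prob_space_iid)
  define A where "A j X = (\<Sum>i\<in>G j. X i) / real (card (G j))" for j and X :: "nat \<Rightarrow> real"
  define bad where "bad j X = (\<bar>A j X - \<mu>\<bar> > r)" for j and X :: "nat \<Rightarrow> real"
  define f where "f j X = (if bad j X then exp 6 else 1 :: real)" for j and X :: "nat \<Rightarrow> real"
  have A_meas: "A j \<in> borel_measurable (PiM I (\<lambda>_. borel))" if "G j \<subseteq> I" for j I
    unfolding A_def by (intro borel_measurable_divide borel_measurable_sum borel_measurable_const
        measurable_component_singleton) (use that in auto)
  have f_meas: "f j \<in> borel_measurable (PiM I (\<lambda>_. borel))" if "G j \<subseteq> I" for j I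
  proof -
    note [measurable] = A_meas[OF that]
    show ?thesis unfolding f_def bad_def by measurable
  qed
  have f_meas_iid: "f j \<in> borel_measurable (iid n D)" if "j < k" for j
    using f_meas[OF sub[OF that]] by (simp cong: measurable_cong_sets add: sets_iid)
  have bad_sets: "{X \<in> space (iid n D). bad j X} \<in> sets (iid n D)" if "j < k" for j
  proof -
    have [measurable]: "A j \<in> borel_measurable (iid n D)"
      using A_meas[OF sub[OF that]] by (simp cong: measurable_cong_sets add: sets_iid)
    show ?thesis unfolding bad_def by measurable
  qed
  have f_restrict: "f j (restrict X (G j)) = f j X" for j X
    by (simp add: f_def bad_def A_def)
  have f_int: "integrable (iid n D) (f j)" if "j < k" for j
    by (rule N.integrable_const_bound[of _ "exp 6"]) (use f_meas_iid[OF that] in \<open>auto simp: f_def\<close>)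
  have indep: "N.indep_vars (\<lambda>_. borel) f {..<k}"
    using indep_blocks[OF n disj sub, of f] f_meas by (simp add: f_restrict)
  have p: "measure (iid n D) {X \<in> space (iid n D). bad j X} \<le> exp (- 6)" if j: "j < k" for j
  proof -
    let ?c = "real (card (G j))"
    have c: "?c > 0" "?c \<ge> m" using m(2)[OF j] m(1) by auto
    have "bad j X \<Longrightarrow> \<bar>\<Sum>i\<in>G j. (X i - \<mu>)\<bar> \<ge> ?c * r" for X
    proof -
      assume "bad j X"
      moreover have "A j X - \<mu> = (\<Sum>i\<in>G j. (X i - \<mu>)) / ?c"
        using c by (simp add: A_def sum_subtractf diff_divide_distrib)
      ultimately show ?thesis using c by (simp add: bad_def field_simps)
    qed
    then have "measure (iid n D) {X \<in> space (iid n D). bad j X}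
        \<le> measure (iid n D) {X \<in> space (iid n D). \<bar>\<Sum>i\<in>G j. (X i - \<mu>)\<bar> \<ge> ?c * r}"
    proof (intro N.finite_measure_mono)
      have [measurable]: "(\<lambda>X. \<Sum>i\<in>G j. (X i - \<mu>)) \<in> borel_measurable (PiM {..<n} (\<lambda>_. borel))"
        by (intro borel_measurable_sum borel_measurable_diff borel_measurable_const
          measurable_component_singleton) (use sub[OF j] in auto)
      have "(\<lambda>X. \<Sum>i\<in>G j. (X i - \<mu>)) \<in> borel_measurable (iid n D)"
        by (simp cong: measurable_cong_sets add: sets_iid)
      then show "{X \<in> space (iid n D). \<bar>\<Sum>i\<in>G j. (X i - \<mu>)\<bar> \<ge> ?c * r} \<in> N.events"
        by measurable
    qed auto
    also have "\<dots> \<le> ?c * \<sigma>\<^sup>2 / (?c * r)\<^sup>2"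
      by (rule chebyshev_sum) (use sub[OF j] c r in auto)
    also have "\<dots> = \<sigma>\<^sup>2 / (?c * r\<^sup>2)" using c by (simp add: power2_eq_square)
    also have "\<dots> \<le> \<sigma>\<^sup>2 / (m * r\<^sup>2)"
      using c m r by (intro divide_left_mono mult_right_mono) auto
    finally show ?thesis using r by linarith
  qed
  have Ef: "(\<integral>X. f j X \<partial>iid n D) \<le> exp 1" if j: "j < k" for j
  proof -
    let ?B = "{X \<in> space (iid n D). bad j X}"
    have "(\<integral>X. f j X \<partial>iid n D) = (\<integral>X. 1 + (exp 6 - 1) * indicator ?B X \<partial>iid n D)"
      by (intro Bochner_Integration.integral_cong) (auto simp: f_def indicator_def)
    also have "\<dots> = 1 + (exp 6 - 1) * measure (iid n D) ?B"
    proof -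
      have "integrable (iid n D) (indicat_real ?B)"
        using bad_sets[OF j] by (intro integrable_real_indicator) (auto simp: N.emeasure_eq_measure)
      moreover have "?B \<inter> space (iid n D) = ?B" by auto
      ultimately show ?thesis using N.prob_space by simp
    qed
    also have "\<dots> \<le> 1 + (exp 6 - 1) * exp (- 6)"
      using p[OF j] by (intro add_left_mono mult_left_mono) auto
    also have "\<dots> \<le> 1 + 1" by (simp add: algebra_simps exp_minus)
    also have "\<dots> \<le> exp 1" using exp_ge_add_one_self[of 1] by simp
    finally show ?thesis .
  qed
  define U where "U X = (\<Prod>j<k. f j X)" for X
  have U_int: "integrable (iid n D) U"
    unfolding U_def using indep f_int by (intro N.indep_vars_integrable) auto
  have "integral\<^sup>L (iid n D) U = (\<Prod>j<k. integral\<^sup>L (iid n D) (f j))"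
    unfolding U_def using indep f_int by (intro N.indep_vars_lebesgue_integral) auto
  also have "\<dots> \<le> (\<Prod>j<k. exp 1)"
    by (intro prod_mono conjI Ef integral_nonneg_AE) (auto simp: f_def)
  also have "\<dots> = exp (real k)" by (simp add: exp_of_nat_mult[symmetric])
  finally have EU: "integral\<^sup>L (iid n D) U \<le> exp (real k)" .
  have U_eq: "U X = exp (6 * real (card {j. j < k \<and> bad j X}))" for X
  proof -
    have "{..<k} \<inter> {j. bad j X} = {j. j < k \<and> bad j X}" by auto
    then have "U X = exp 6 ^ card {j. j < k \<and> bad j X}"
      unfolding U_def f_def by (subst prod.If_cases) auto
    then show ?thesis by (simp add: exp_of_nat_mult[symmetric] mult.commute)
  qed
  have "U X \<ge> exp (3 * real k)" if "\<bar>median (map (\<lambda>j. A j X) [0..<k]) - \<mu>\<bar> > r" for X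
  proof -
    have "length (map (\<lambda>j. A j X) [0..<k]) \<le>
        2 * length (filter (\<lambda>y. \<bar>y - \<mu>\<bar> > r) (map (\<lambda>j. A j X) [0..<k]))"
      using k that by (intro median_far_imp_half_far) auto
    then have "k \<le> 2 * card {j. j < k \<and> bad j X}"
      by (simp add: length_filter_conv_card bad_def cong: conj_cong)
    then show ?thesis unfolding U_eq by simp
  qed
  then have "measure (iid n D) {X \<in> space (iid n D). \<bar>median (map (\<lambda>j. A j X) [0..<k]) - \<mu>\<bar> > r}
      \<le> measure (iid n D) {X \<in> space (iid n D). U X \<ge> exp (3 * real k)}"
    using U_int by (intro N.finite_measure_mono) auto
  also have "\<dots> \<le> integral\<^sup>L (iid n D) U / exp (3 * real k)"
    by (rule integral_Markov_inequality_measure[OF U_int sets.top]) (auto simp: U_eq)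
  also have "\<dots> \<le> exp (real k) / exp (3 * real k)" by (intro divide_right_mono EU) auto
  also have "\<dots> = exp (- 2 * real k)" by (simp add: exp_diff[symmetric])
  finally show ?thesis unfolding A_def .
qed
end

section \<open>The upper bound\<close>

lemma balanced_partition_card:
  assumes bp: "balanced_partition n k G" and j: "j < k"
  shows "real n / real k - 1 \<le> real (card (G j))"
proof -
  have U: "(\<Union>i<k. G i) = {..<n}" and disj: "disjoint_family_on G {..<k}"
    and size: "\<And>i. i < k \<Longrightarrow> card (G i) \<le> card (G j) + 1"
    using bp j by (auto simp: balanced_partition_def)
  have "finite (G i)" if "i < k" for i
    using U that by (metis UN_upper finite_lessThan finite_subset lessThan_iff)
  then have "n = (\<Sum>i<k. card (G i))"
    using card_UN_disjoint[of "{..<k}" G] disj U by (simp add: disjoint_family_on_def)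
  also have "\<dots> \<le> (\<Sum>i<k. card (G j) + 1)" by (intro sum_mono size) auto
  also have "\<dots> = k * (card (G j) + 1)" by simp
  finally have "real n \<le> real k * (real (card (G j)) + 1)"
    by (metis of_nat_1 of_nat_add of_nat_le_iff of_nat_mult)
  then show ?thesis using j by (simp add: field_simps)
qed

context square_integrable_distribution
begin

lemma main_estimator_events:
  assumes "balanced_partition n (num_groups \<delta>) (P n \<delta>)" "num_groups \<delta> > 0" "n > 0" "0 < \<delta>" "\<delta> < 1"
  shows "{X \<in> space (iid n D). \<bar>main_estimator P n \<delta> X - \<mu>\<bar> \<le> b} \<in> sets (iid n D)"
proof -
  have [measurable]: "main_estimator P n \<delta> \<in> borel_measurable (iid n D)"
    using borel_measurable_main_estimator[of n \<delta> P] assms by (simp cong: measurable_cong_sets add: sets_iid)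
  show ?thesis by measurable
qed

text \<open>If \<open>\<sigma> = 0\<close> then \<open>u = 0\<close> and no scale can be measured in units of \<open>u\<close>; but then the sample is
almost surely constant.\<close>

lemma degenerate_bound:
  assumes bp: "balanced_partition n (num_groups \<delta>) (P n \<delta>)" "num_groups \<delta> > 0"
    and nonempty: "\<And>j. j < num_groups \<delta> \<Longrightarrow> card (P n \<delta> j) > 0"
    and \<delta>: "n > 0" "0 < \<delta>" "\<delta> < 1" and "\<sigma> = 0"
  shows "measure (iid n D) {X \<in> space (iid n D). \<bar>main_estimator P n \<delta> X - \<mu>\<bar> \<le> 0} = 1"
proof -
  interpret N: prob_space "iid n D" by (rule prob_space_iid)
  have "(\<integral>x. (x - \<mu>)\<^sup>2 \<partial>D) = 0" using std_dev_square \<open>\<sigma> = 0\<close> by simp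
  then have "AE x in D. (x - \<mu>)\<^sup>2 = 0"
    using integral_nonneg_eq_0_iff_AE[OF integrable_square_shift[of \<mu>]] by simp
  then have AE_D: "AE x in D. x = \<mu>" by simp
  have "AE X in iid n D. \<forall>i\<in>{..<n}. X i = \<mu>"
    by (intro AE_finite_allI AE_PiM_component) (use AE_D prob_space_axioms in auto)
  then have "AE X in iid n D. \<bar>main_estimator P n \<delta> X - \<mu>\<bar> \<le> 0"
  proof (rule AE_mp, intro AE_I2 impI)
    fix X assume X: "\<forall>i\<in>{..<n}. X i = \<mu>"
    let ?k = "median_of_means P n \<delta> X"
    let ?xs = "map (\<lambda>j. (\<Sum>i\<in>P n \<delta> j. X i) / real (card (P n \<delta> j))) [0..<num_groups \<delta>]"
    have "y = \<mu>" if "y \<in> set ?xs" for y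
    proof -
      from that obtain j where j: "j < num_groups \<delta>"
        and y: "y = (\<Sum>i\<in>P n \<delta> j. X i) / real (card (P n \<delta> j))" by auto
      have "P n \<delta> j \<subseteq> {..<n}" using bp(1) j by (auto simp: balanced_partition_def)
      then have "(\<Sum>i\<in>P n \<delta> j. X i) = (\<Sum>i\<in>P n \<delta> j. \<mu>)" using X by (intro sum.cong) auto
      then show ?thesis using nonempty[OF j] by (simp add: y)
    qed
    then have "filter (\<lambda>y. \<bar>y - \<mu>\<bar> > 0) ?xs = []" by (auto simp: filter_empty_conv)
    moreover have "?xs \<noteq> []" using bp(2) by simp
    ultimately have "\<not> \<bar>median ?xs - \<mu>\<bar> > 0"
      using median_far_imp_half_far[of ?xs 0 \<mu>] by (metis length_0_conv le_zero_eq list.size(3) mult_0_right)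
    then have k: "?k = \<mu>" by (simp add: median_of_means_def)
    obtain s where "main_estimator P n \<delta> X = truncated_mean n s ?k X"
      using main_estimator_truncated_mean[of 0 \<delta> P n X] \<delta> by auto
    also have "\<dots> = \<mu>" unfolding k using X by (simp add: truncated_mean_def)
    finally show "\<bar>main_estimator P n \<delta> X - \<mu>\<bar> \<le> 0" by simp
  qed
  then show ?thesis
    using main_estimator_events[of n \<delta> P 0] bp \<delta> by (subst N.prob_eq_1) auto
qed

text \<open>A centre within \<open>K u\<close> of the mean costs a relative amount \<open>K\<^sup>2 L / n\<close> in the variance term, which
is negligible because \<open>L / n\<close> is small.\<close>

lemma chernoff_test:
  assumes n: "n > 0" and L: "L > 0" and \<sigma>: "\<sigma> > 0" and u: "u = \<sigma> * sqrt (L / real n)"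
    and w: "0 < \<beta>" "0 \<le> c" "c * \<beta>\<^sup>2 \<le> 2"
      "\<And>y. exp (a * psi y + b * rho y) \<le> 1 + a * y + c * y\<^sup>2"
    and k: "\<bar>k - \<mu>\<bar> \<le> K * u"
    and small: "2 * K\<^sup>2 * (L / real n) \<le> \<eta>"
  shows "measure (iid n D) {X \<in> space (iid n D).
      a * (\<beta> * L / u * (truncated_mean n (\<beta> * L / (real n * u)) k X - \<mu>)) + b * load n (\<beta> * L / (real n * u)) k X
      \<ge> L * (1 + c * \<beta>\<^sup>2 + 2 * \<eta>)} \<le> exp (- L * (1 + \<eta>))"
proof -
  define s where "s = \<beta> * L / (real n * u)"
  have u0: "u > 0" using n L \<sigma> by (simp add: u)
  have u2: "real n * u\<^sup>2 = \<sigma>\<^sup>2 * L" using n L by (simp add: u power_mult_distrib)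
  have s: "s > 0" "real n * s = \<beta> * L / u" using n L u0 w by (simp_all add: s_def)
  have "real n * (c * s\<^sup>2 * (\<sigma>\<^sup>2 + (\<mu> - k)\<^sup>2)) \<le> L * (c * \<beta>\<^sup>2) + L * \<eta>"
  proof -
    have ns2: "real n * s\<^sup>2 = \<beta>\<^sup>2 * L / \<sigma>\<^sup>2"
    proof -
      have "real n * s\<^sup>2 = \<beta>\<^sup>2 * L\<^sup>2 / (real n * u\<^sup>2)"
        using n by (simp add: s_def power_divide power_mult_distrib power2_eq_square mult_ac)
      also have "\<dots> = \<beta>\<^sup>2 * L / \<sigma>\<^sup>2" unfolding u2 using L by (simp add: power2_eq_square)
      finally show ?thesis .
    qed
    have "real n * (c * s\<^sup>2 * \<sigma>\<^sup>2) = c * (real n * s\<^sup>2) * \<sigma>\<^sup>2" by simp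
    also have "\<dots> = L * (c * \<beta>\<^sup>2)" unfolding ns2 using \<sigma> by simp
    finally have first: "real n * (c * s\<^sup>2 * \<sigma>\<^sup>2) = L * (c * \<beta>\<^sup>2)" .
    have "(\<mu> - k)\<^sup>2 \<le> (K * u)\<^sup>2"
      using k by (metis abs_minus_commute abs_ge_zero order_trans power2_abs power_mono)
    also have "\<dots> = K\<^sup>2 * (\<sigma>\<^sup>2 * (L / real n))" using L n by (simp add: u power_mult_distrib)
    finally have dist: "(\<mu> - k)\<^sup>2 \<le> K\<^sup>2 * (\<sigma>\<^sup>2 * (L / real n))" .
    have "real n * (c * s\<^sup>2 * (\<mu> - k)\<^sup>2) = c * (real n * s\<^sup>2) * (\<mu> - k)\<^sup>2" by simp
    also have "\<dots> \<le> c * (real n * s\<^sup>2) * (K\<^sup>2 * (\<sigma>\<^sup>2 * (L / real n)))"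
      using dist w by (intro mult_left_mono) auto
    also have "\<dots> = L * ((c * \<beta>\<^sup>2) * (K\<^sup>2 * (L / real n)))" unfolding ns2 using \<sigma> by simp
    also have "\<dots> \<le> L * (2 * (K\<^sup>2 * (L / real n)))"
      using w L by (intro mult_left_mono mult_right_mono) auto
    also have "\<dots> \<le> L * \<eta>" using small L by (intro mult_left_mono) (auto simp: mult.assoc)
    finally show ?thesis using first by (simp only: distrib_left)
  qed
  then have "exp (- (L * (1 + c * \<beta>\<^sup>2 + 2 * \<eta>)) + real n * (c * s\<^sup>2 * (\<sigma>\<^sup>2 + (\<mu> - k)\<^sup>2)))
      \<le> exp (- L * (1 + \<eta>))"
    by (simp add: algebra_simps)
  moreover have "measure (iid n D) {X \<in> space (iid n D).
      a * (real n * s * (truncated_mean n s k X - \<mu>)) + b * load n s k X \<ge> L * (1 + c * \<beta>\<^sup>2 + 2 * \<eta>)}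
      \<le> exp (- (L * (1 + c * \<beta>\<^sup>2 + 2 * \<eta>)) + real n * (c * s\<^sup>2 * (\<sigma>\<^sup>2 + (\<mu> - k)\<^sup>2)))"
    by (rule chernoff) (use s n w in auto)
  ultimately show ?thesis unfolding s(2) unfolding s_def by linarith
qed

text \<open>The union bound. The centres are multiples of \<open>h u\<close> away from the mean, within \<open>K u\<close> of it; apart from the
event that the median of means is farther away, a large error triggers one of the tests at one of these centres.
Both contributions are at most \<open>\<delta>/2\<close>.\<close>

lemma nondegenerate_bound:
  fixes W :: "(real \<times> real \<times> real \<times> real) set"
  defines "K \<equiv> 2 * exp 3 + 1"
  assumes \<xi>: "0 < \<xi>" "\<xi> \<le> 1" and h: "h = \<xi>\<^sup>2 / 2000" and \<sigma>: "\<sigma> > 0"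
    and W: "test_family \<xi> h W"
    and Q: "K / h \<le> real Q"
    and P: "balanced_partition n (num_groups \<delta>) (P n \<delta>)" "num_groups \<delta> > 0"
    and \<delta>: "n > 0" "0 < \<delta>" "\<delta> < 1" and L: "L = ln (1 / \<delta>)" "1 \<le> L"
    and ratio: "L / real n \<le> 1/4" "2 * K\<^sup>2 * (L / real n) \<le> \<xi> / 80"
    and large: "real (card W * (2 * Q + 1)) * exp (- (\<xi> / 80) * L) \<le> 1/2"
  shows "measure (iid n D) {X \<in> space (iid n D).
      \<bar>main_estimator P n \<delta> X - \<mu>\<bar> \<le> \<sigma> * (1 + \<xi>) * sqrt (2 * L / real n)} \<ge> 1 - \<delta>"
proof -
  interpret N: prob_space "iid n D" by (rule prob_space_iid)
  define u where "u = \<sigma> * sqrt (L / real n)"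
  have u0: "u > 0" using L \<delta> \<sigma> by (simp add: u_def)
  have h0: "0 < h" "h \<le> 1" using \<xi> mult_le_one[of \<xi> \<xi>] by (auto simp: h power2_eq_square)
  define good where "good = {X \<in> space (iid n D).
      \<bar>main_estimator P n \<delta> X - \<mu>\<bar> \<le> \<sigma> * (1 + \<xi>) * sqrt (2 * L / real n)}"
  have good_sets: "good \<in> sets (iid n D)" unfolding good_def using P \<delta> by (rule main_estimator_events)
  have u_eq: "\<sigma> * (1 + \<xi>) * sqrt (2 * L / real n) = sqrt 2 * (1 + \<xi>) * u"
    by (simp add: u_def real_sqrt_mult real_sqrt_divide)
  define m where "m = num_groups \<delta>"
  have m: "L \<le> real m" "real m \<le> 2 * L" "m > 0"
    using L P(2) by (auto simp: m_def num_groups_def L(1)[symmetric]) linarith+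
  have card: "real n / (4 * L) \<le> real (card (P n \<delta> j))" if "j < m" for j
  proof -
    have "real n / (4 * L) \<ge> 1" using ratio \<delta> L by (simp add: field_simps)
    moreover have "real n / (2 * L) \<le> real n / real m" using m \<delta> L by (intro divide_left_mono) auto
    moreover have "real n / (2 * L) = 2 * (real n / (4 * L))" by simp
    moreover have "real n / real m - 1 \<le> real (card (P n \<delta> j))"
      unfolding m_def by (rule balanced_partition_card[OF P(1)]) (use that in \<open>simp add: m_def\<close>)
    ultimately show ?thesis by linarith
  qed
  \<comment> \<open>The constant is chosen so that Chebyshev gives \<open>exp (- 6)\<close> for the mean of a single group.\<close>
  define far where "far = {X \<in> space (iid n D). \<bar>median_of_means P n \<delta> X - \<mu>\<bar> > 2 * exp 3 * u}"
  have far_sets: "far \<in> sets (iid n D)"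
  proof -
    have [measurable]: "median_of_means P n \<delta> \<in> borel_measurable (iid n D)"
      using borel_measurable_median_of_means[of n \<delta> P] P by (simp cong: measurable_cong_sets add: sets_iid)
    show ?thesis unfolding far_def by measurable
  qed
  have "measure (iid n D) far \<le> exp (- 2 * real m)"
    unfolding far_def median_of_means_def m_def[symmetric]
  proof (rule median_of_means_concentration)
    show "n > 0" "m > 0" using \<delta> m by auto
    show "disjoint_family_on (P n \<delta>) {..<m}" "\<And>j. j < m \<Longrightarrow> P n \<delta> j \<subseteq> {..<n}"
      using P by (auto simp: balanced_partition_def m_def)
    show "0 < real n / (4 * L)" "\<And>j. j < m \<Longrightarrow> real n / (4 * L) \<le> real (card (P n \<delta> j))"
      using \<delta> L card by auto
    show "0 < 2 * exp 3 * u" using u0 by simp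
    have "real n / (4 * L) * (2 * exp 3 * u)\<^sup>2 = exp 3 ^ 2 * \<sigma>\<^sup>2"
      using \<delta> L by (simp add: u_def power_mult_distrib)
    also have "exp 3 ^ 2 = exp (6::real)" by (simp add: exp_of_nat_mult[symmetric])
    finally show "\<sigma>\<^sup>2 / (real n / (4 * L) * (2 * exp 3 * u)\<^sup>2) \<le> exp (- 6)"
      using \<sigma> by (simp add: exp_minus field_simps)
  qed
  also have "\<dots> \<le> exp (- L - 1)" using m L by simp
  also have "\<dots> \<le> exp (- L) / 2"
  proof -
    have "exp (-1) \<le> (1/2::real)" using exp_ge_add_one_self[of 1] by (simp add: exp_minus field_simps)
    then have "exp (- L) * exp (-1) \<le> exp (-L) * (1/2)" by (intro mult_left_mono) auto
    then show ?thesis by (simp add: exp_add[symmetric])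
  qed
  finally have p_far: "measure (iid n D) far \<le> exp (- L) / 2" .
  define grid where "grid q = \<mu> + real_of_int q * (h * u)" for q :: int
  define hit where "hit = (\<lambda>((a, b, c, \<beta>), q). {X \<in> space (iid n D).
      a * (\<beta> * L / u * (truncated_mean n (\<beta> * L / (real n * u)) (grid q) X - \<mu>))
        + b * load n (\<beta> * L / (real n * u)) (grid q) X \<ge> L * (1 + c * \<beta>\<^sup>2 + \<xi>/40)})"
  define I where "I = W \<times> {q. \<bar>real_of_int q * h\<bar> \<le> K}"
  have Qset: "{q. \<bar>real_of_int q * h\<bar> \<le> K} \<subseteq> {- int Q..int Q}"
  proof
    fix q assume "q \<in> {q. \<bar>real_of_int q * h\<bar> \<le> K}"
    then have "\<bar>real_of_int q\<bar> \<le> K / h" using h0 by (simp add: abs_mult field_simps)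
    then have "\<bar>real_of_int q\<bar> \<le> real Q" using Q by linarith
    then show "q \<in> {- int Q..int Q}" by (auto simp: abs_le_iff)
  qed
  then have finI: "finite I" unfolding I_def using test_familyD(1)[OF W] finite_subset by blast
  have "card {q. \<bar>real_of_int q * h\<bar> \<le> K} \<le> card {- int Q..int Q}" by (intro card_mono Qset) auto
  then have cardI: "card I \<le> card W * (2 * Q + 1)"
    unfolding I_def card_cartesian_product by (intro mult_left_mono) auto
  have hit_sets: "hit i \<in> sets (iid n D)" for i
  proof -
    obtain a b c \<beta> q where i: "i = ((a, b, c, \<beta>), q)" by (metis prod.exhaust)
    have [measurable]: "(\<lambda>X. truncated_mean n s k X) \<in> borel_measurable (iid n D)"
      "(\<lambda>X. load n s k X) \<in> borel_measurable (iid n D)" for s k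
      using borel_measurable_truncated_mean[of "\<lambda>_. s" n "\<lambda>_. k"] borel_measurable_load[of "\<lambda>_. s" n "\<lambda>_. k"]
      by (simp_all cong: measurable_cong_sets add: sets_iid)
    show ?thesis unfolding hit_def i by simp
  qed
  have p_hit: "measure (iid n D) (hit i) \<le> exp (- L * (1 + \<xi>/80))" if "i \<in> I" for i
  proof -
    obtain a b c \<beta> q where i: "i = ((a, b, c, \<beta>), q)" by (metis prod.exhaust)
    have w: "(a, b, c, \<beta>) \<in> W" and q: "\<bar>real_of_int q * h\<bar> \<le> K" using that by (auto simp: I_def i)
    have "\<bar>grid q - \<mu>\<bar> = \<bar>real_of_int q * h\<bar> * u" using u0 by (simp add: grid_def abs_mult mult.assoc)
    also have "\<dots> \<le> K * u" using q u0 by (intro mult_right_mono) auto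
    finally have "\<bar>grid q - \<mu>\<bar> \<le> K * u" .
    from chernoff_test[OF \<delta>(1) _ \<sigma> u_def _ _ _ _ this ratio(2), of \<beta> c a b] test_familyD(2)[OF W w] L
    show ?thesis unfolding hit_def i by simp
  qed
  have cover: "space (iid n D) - good \<subseteq> far \<union> (\<Union>i\<in>I. hit i)"
  proof
    fix X assume X: "X \<in> space (iid n D) - good"
    define k where "k = median_of_means P n \<delta> X"
    show "X \<in> far \<union> (\<Union>i\<in>I. hit i)"
    proof (cases "X \<in> far")
      case False
      then have k: "\<bar>k - \<mu>\<bar> \<le> 2 * exp 3 * u" using X by (auto simp: far_def k_def)
      define q where "q = \<lfloor>(k - \<mu>) / (h * u)\<rfloor>"
      have hu: "h * u > 0" using h0 u0 by simp
      have "real_of_int q \<le> (k - \<mu>) / (h * u)" "(k - \<mu>) / (h * u) < real_of_int q + 1"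
        by (auto simp: q_def)
      then have "real_of_int q * (h * u) \<le> k - \<mu>" "k - \<mu> < (real_of_int q + 1) * (h * u)"
        using hu by (auto simp: pos_le_divide_eq pos_divide_less_eq)
      then have kq: "\<bar>k - grid q\<bar> \<le> h * u" by (simp add: grid_def algebra_simps abs_le_iff)
      have "\<bar>real_of_int q * h\<bar> * u = \<bar>grid q - \<mu>\<bar>" using u0 by (simp add: grid_def abs_mult mult.assoc)
      also have "\<dots> \<le> 2 * exp 3 * u + h * u" using k kq by (simp add: abs_le_iff)
      also have "\<dots> \<le> K * u" using h0 u0 by (simp add: K_def algebra_simps)
      finally have q: "\<bar>real_of_int q * h\<bar> \<le> K" using u0 by simp
      obtain s where s: "s > 0" "main_estimator P n \<delta> X = truncated_mean n s k X" "load n s k X \<le> L/3"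
        "s < 4/\<xi> * L / (real n * u) \<longrightarrow> load n s k X = L/3"
        using main_estimator_truncated_mean[of "4/\<xi> * L / (real n * u)" \<delta> P n X] \<xi> L \<delta> u0
        by (auto simp: k_def)
      have dev: "\<bar>truncated_mean n s k X - \<mu>\<bar> \<ge> sqrt 2 * (1 + \<xi>) * u"
        using X unfolding good_def u_eq by (auto simp: s(2)[symmetric])
      have "L > 0" using L by simp
      from test_familyD(3)[OF W \<delta>(1) this u0 kq s(1,3,4) dev] obtain a b c \<beta> where
        "(a, b, c, \<beta>) \<in> W" "a * (\<beta> * L / u * (truncated_mean n (\<beta> * L / (real n * u)) (grid q) X - \<mu>))
          + b * load n (\<beta> * L / (real n * u)) (grid q) X \<ge> L * (1 + c * \<beta>\<^sup>2 + \<xi>/40)" by auto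
      then have "((a, b, c, \<beta>), q) \<in> I" "X \<in> hit ((a, b, c, \<beta>), q)"
        using q X by (auto simp: I_def hit_def)
      then show ?thesis by blast
    qed simp
  qed
  have hits_sets: "(\<Union>i\<in>I. hit i) \<in> sets (iid n D)"
    by (intro sets.finite_UN finI hit_sets)
  have "1 - measure (iid n D) good = measure (iid n D) (space (iid n D) - good)"
    using N.prob_compl[OF good_sets] by simp
  also have "\<dots> \<le> measure (iid n D) (far \<union> (\<Union>i\<in>I. hit i))"
    by (intro N.finite_measure_mono cover sets.Un far_sets hits_sets)
  also have "\<dots> \<le> measure (iid n D) far + measure (iid n D) (\<Union>i\<in>I. hit i)"
    by (intro measure_Un_le far_sets hits_sets)
  also have "measure (iid n D) (\<Union>i\<in>I. hit i) \<le> (\<Sum>i\<in>I. measure (iid n D) (hit i))"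
    by (intro measure_UNION_le finI hit_sets)
  also have "\<dots> \<le> (\<Sum>i\<in>I. exp (- L * (1 + \<xi>/80)))" by (intro sum_mono p_hit)
  also have "\<dots> \<le> real (card W * (2 * Q + 1)) * exp (- L * (1 + \<xi>/80))"
    using cardI by (simp del: of_nat_mult of_nat_add)
  also have "\<dots> = real (card W * (2 * Q + 1)) * exp (- (\<xi> / 80) * L) * exp (- L)"
    by (simp add: exp_add[symmetric] algebra_simps)
  also have "\<dots> \<le> 1/2 * exp (- L)" by (intro mult_right_mono large) auto
  finally have "1 - measure (iid n D) good \<le> exp (- L)" using p_far by linarith
  also have "exp (- L) = \<delta>" using \<delta> by (simp add: L(1) ln_div)
  finally show ?thesis unfolding good_def by linarith
qed
end

theorem main_estimator_upper_bound:
  fixes \<xi> :: real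
  assumes P: "partition_scheme P" and \<xi>: "\<xi> > 0"
  shows "\<exists>\<tau>>0. \<forall>(n::nat) (\<delta>::real). n > 0 \<and> 0 < \<delta> \<and> \<delta> < 1 \<and>
      ln (1 / \<delta>) / real n < \<tau> \<and> \<delta> < \<tau> \<longrightarrow>
      (\<forall>D :: real measure. real_distribution D \<and> integrable D (\<lambda>x. x\<^sup>2) \<longrightarrow>
         \<P>(X in iid n D.
            \<bar>main_estimator P n \<delta> X - mean D\<bar>
              \<le> std_dev D * (1 + \<xi>) * sqrt (2 * ln (1 / \<delta>) / real n)) \<ge> 1 - \<delta>)"
proof -
  define z where "z = min \<xi> 1"
  have z: "0 < z" "z \<le> 1" "z \<le> \<xi>" using \<xi> by (auto simp: z_def)
  define h where "h = z\<^sup>2 / 2000"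
  define K where "K = 2 * exp 3 + (1::real)"
  have K: "K > 0" by (simp add: K_def add_pos_pos)
  obtain W where W: "test_family z h W" using ex_test_family[OF z(1,2) h_def] ..
  obtain Q :: nat where Q: "K / h \<le> real Q" using real_arch_simple by blast
  define C where "C = real (card W * (2 * Q + 1)) + 1"
  \<comment> \<open>\<open>L > M\<close> makes the size of the grid negligible against \<open>exp (- z L / 80)\<close>.\<close>
  define M where "M = max 1 (80 / z * ln (2 * C))"
  define \<tau> where "\<tau> = min (exp (- M)) (min (1/4) (z / (160 * K\<^sup>2)))"
  show ?thesis
  proof (intro exI[of _ \<tau>] conjI allI impI)
    show "\<tau> > 0" using z K by (simp add: \<tau>_def)
    fix n :: nat and \<delta> :: real and D :: "real measure"
    assume A: "n > 0 \<and> 0 < \<delta> \<and> \<delta> < 1 \<and> ln (1 / \<delta>) / real n < \<tau> \<and> \<delta> < \<tau>"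
      and D: "real_distribution D \<and> integrable D (\<lambda>x. x\<^sup>2)"
    interpret real_distribution D using D by simp
    interpret square_integrable_distribution D by unfold_locales (use D in auto)
    interpret N: prob_space "iid n D" by (rule prob_space_iid)
    define L where "L = ln (1 / \<delta>)"
    have "ln \<delta> < ln (exp (- M))" using A by (subst ln_less_cancel_iff) (auto simp: \<tau>_def)
    then have LM: "M < L" using A by (simp add: L_def ln_div)
    then have L1: "1 \<le> L" by (simp add: M_def)
    have ratio: "L / real n \<le> 1/4" "L / real n \<le> z / (160 * K\<^sup>2)" using A by (auto simp: L_def \<tau>_def)
    have ratio2: "2 * K\<^sup>2 * (L / real n) \<le> z / 80"
    proof -
      have "2 * K\<^sup>2 * (L / real n) \<le> 2 * K\<^sup>2 * (z / (160 * K\<^sup>2))" by (intro mult_left_mono ratio) auto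
      then show ?thesis using K by simp
    qed
    have C1: "C \<ge> 1" by (simp add: C_def)
    have large: "real (card W * (2 * Q + 1)) * exp (- (z / 80) * L) \<le> 1/2"
    proof -
      have "80 / z * ln (2 * C) \<le> L" using LM by (simp add: M_def)
      then have "ln (2 * C) \<le> z / 80 * L" using z by (simp add: field_simps)
      then have "exp (- (z / 80) * L) \<le> exp (- ln (2 * C))" by simp
      also have "\<dots> = 1 / (2 * C)" using C1 by (simp add: exp_minus inverse_eq_divide)
      finally have "real (card W * (2 * Q + 1)) * exp (- (z / 80) * L) \<le> C * (1 / (2 * C))"
        using C1 by (intro mult_mono) (auto simp: C_def)
      then show ?thesis using C1 by simp
    qed
    have groups: "num_groups \<delta> > 0" "real (num_groups \<delta>) \<le> 2 * L"
      using L1 by (auto simp: num_groups_def L_def[symmetric]) linarith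
    have "L \<le> real n" using ratio(1) A by (simp add: field_simps)
    then have "num_groups \<delta> \<le> n"
      by (simp add: num_groups_def L_def[symmetric] ceiling_le_iff)
    then have bp: "balanced_partition n (num_groups \<delta>) (P n \<delta>)"
      using P A by (simp add: partition_scheme_def)
    define good where "good b = {X \<in> space (iid n D). \<bar>main_estimator P n \<delta> X - \<mu>\<bar> \<le> b}" for b
    have good_sets: "good b \<in> sets (iid n D)" for b
      unfolding good_def by (rule main_estimator_events) (use bp groups A in auto)
    have "measure (iid n D) (good (\<sigma> * (1 + \<xi>) * sqrt (2 * L / real n))) \<ge> 1 - \<delta>"
    proof (cases "\<sigma> = 0")
      case True
      have "card (P n \<delta> j) > 0" if "j < num_groups \<delta>" for j
      proof -
        have "real n / real (num_groups \<delta>) \<ge> real n / (2 * L)"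
          using groups L1 A by (intro divide_left_mono) auto
        moreover have "real n / (2 * L) \<ge> 2" using ratio(1) A L1 by (simp add: field_simps)
        ultimately show ?thesis using balanced_partition_card[OF bp that] by linarith
      qed
      then have "measure (iid n D) (good 0) = 1"
        unfolding good_def using A True bp groups by (intro degenerate_bound) auto
      then show ?thesis using A True by simp
    next
      case False
      then have "\<sigma> > 0" using std_dev_nonneg by simp
      then have "measure (iid n D) (good (\<sigma> * (1 + z) * sqrt (2 * L / real n))) \<ge> 1 - \<delta>"
        unfolding good_def using A bp groups L1 ratio(1) ratio2 large Q z
        by (intro nondegenerate_bound[where h = h and W = W and Q = Q])
          (auto simp: h_def L_def K_def W[unfolded h_def])
      also have "measure (iid n D) (good (\<sigma> * (1 + z) * sqrt (2 * L / real n)))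
          \<le> measure (iid n D) (good (\<sigma> * (1 + \<xi>) * sqrt (2 * L / real n)))"
      proof (rule N.finite_measure_mono[OF _ good_sets])
        have "\<sigma> * (1 + z) * sqrt (2 * L / real n) \<le> \<sigma> * (1 + \<xi>) * sqrt (2 * L / real n)"
          using z L1 std_dev_nonneg by (intro mult_right_mono mult_left_mono) auto
        then show "good (\<sigma> * (1 + z) * sqrt (2 * L / real n)) \<subseteq> good (\<sigma> * (1 + \<xi>) * sqrt (2 * L / real n))"
          by (auto simp: good_def)
      qed
      finally show ?thesis .
    qed
    then show "\<P>(X in iid n D. \<bar>main_estimator P n \<delta> X - mean D\<bar>
              \<le> std_dev D * (1 + \<xi>) * sqrt (2 * ln (1 / \<delta>) / real n)) \<ge> 1 - \<delta>"
      by (simp add: good_def L_def)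
  qed
qed

section \<open>The lower bound for Gaussian samples\<close>

definition unit_gaussian :: "real \<Rightarrow> real measure" where
  "unit_gaussian m = density lborel (normal_density m 1)"

lemma prob_space_unit_gaussian: "prob_space (unit_gaussian m)"
  unfolding unit_gaussian_def by (rule prob_space_normal_density) simp

lemma sets_unit_gaussian [simp, measurable_cong]: "sets (unit_gaussian m) = sets borel"
  and space_unit_gaussian [simp]: "space (unit_gaussian m) = UNIV"
  by (simp_all add: unit_gaussian_def)

lemma gaussian_unit_gaussian: "gaussian (unit_gaussian m)"
  unfolding gaussian_def unit_gaussian_def by (intro exI[of _ m] exI[of _ 1]) simp

lemma mean_unit_gaussian: "mean (unit_gaussian m) = m"
proof -
  interpret prob_space "unit_gaussian m" by (rule prob_space_unit_gaussian)
  have "distributed (unit_gaussian m) lborel (\<lambda>x. x) (normal_density m 1)"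
    by (simp add: distributed_def distr_id2 unit_gaussian_def cong: distr_cong)
  then show ?thesis unfolding mean_def by (intro normal_distributed_expectation) auto
qed

lemma std_dev_unit_gaussian: "std_dev (unit_gaussian m) = 1"
proof -
  interpret prob_space "unit_gaussian m" by (rule prob_space_unit_gaussian)
  have "distributed (unit_gaussian m) lborel (\<lambda>x. x) (normal_density m 1)"
    by (simp add: distributed_def distr_id2 unit_gaussian_def cong: distr_cong)
  then have "variance (\<lambda>x. x) = 1\<^sup>2" by (intro normal_distributed_variance) auto
  then show ?thesis unfolding std_dev_def by simp
qed

lemma sq_unit_gaussian: "integrable (unit_gaussian m) (\<lambda>x. x\<^sup>2)"
proof -
  have "integrable lborel (\<lambda>x. normal_density m 1 x * (x - m) ^ k)" for k
    by (rule integrable_normal_moment) simp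
  from this[of 2] this[of 1] this[of 0]
  have "integrable lborel (\<lambda>x. normal_density m 1 x * (x - m) ^ 2 + 2 * m * (normal_density m 1 x * (x - m)^1)
      + m\<^sup>2 * (normal_density m 1 x * (x - m)^0))"
    by (intro Bochner_Integration.integrable_add integrable_mult_right) auto
  also have "(\<lambda>x. normal_density m 1 x * (x - m) ^ 2 + 2 * m * (normal_density m 1 x * (x - m)^1)
      + m\<^sup>2 * (normal_density m 1 x * (x - m)^0)) = (\<lambda>x. normal_density m 1 x * x\<^sup>2)"
    by (rule ext) (simp add: algebra_simps power2_eq_square)
  finally show ?thesis unfolding unit_gaussian_def
    by (subst integrable_density) (auto simp: normal_density_nonneg)
qed

lemma unit_gaussian_shift_density:
  "unit_gaussian (m + d) = density (unit_gaussian m) (\<lambda>x. exp (d * (x - m) - d\<^sup>2 / 2))"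
proof -
  have "normal_density (m + d) 1 x = normal_density m 1 x * exp (d * (x - m) - d\<^sup>2 / 2)" for x
    unfolding normal_density_def
    by (simp add: exp_add[symmetric] power2_eq_square field_simps)
  then show ?thesis unfolding unit_gaussian_def
    by (subst density_density_eq) (auto simp: ennreal_mult' normal_density_nonneg)
qed

lemma PiM_density:
  assumes "sigma_finite_measure M" "sigma_finite_measure (density M f)" "finite I"
    and [measurable]: "f \<in> borel_measurable M"
  shows "PiM I (\<lambda>_. density M f) = density (PiM I (\<lambda>_. M)) (\<lambda>x. \<Prod>i\<in>I. f (x i))"
proof -
  interpret M: product_sigma_finite "\<lambda>_. M" by (simp add: product_sigma_finite_def assms)
  interpret N: product_sigma_finite "\<lambda>_. density M f" by (simp add: product_sigma_finite_def assms)
  have "density (PiM I (\<lambda>_. M)) (\<lambda>x. \<Prod>i\<in>I. f (x i)) = PiM I (\<lambda>_. density M f)"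
  proof (rule N.PiM_eqI[OF assms(3)])
    show "sets (density (PiM I (\<lambda>_. M)) (\<lambda>x. \<Prod>i\<in>I. f (x i))) = sets (PiM I (\<lambda>_. density M f))"
      by (simp cong: sets_PiM_cong)
    fix A assume A: "\<And>i. i \<in> I \<Longrightarrow> A i \<in> sets (density M f)"
    then have A' [measurable]: "\<And>i. i \<in> I \<Longrightarrow> A i \<in> sets M" by simp
    have "emeasure (density (PiM I (\<lambda>_. M)) (\<lambda>x. \<Prod>i\<in>I. f (x i))) (Pi\<^sub>E I A)
        = (\<integral>\<^sup>+x. (\<Prod>i\<in>I. f (x i)) * indicator (Pi\<^sub>E I A) x \<partial>PiM I (\<lambda>_. M))"
      using A' assms(3) by (intro emeasure_density sets_PiM_I_finite) auto
    also have "\<dots> = (\<integral>\<^sup>+x. (\<Prod>i\<in>I. f (x i) * indicator (A i) (x i)) \<partial>PiM I (\<lambda>_. M))"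
    proof (intro nn_integral_cong)
      fix x assume "x \<in> space (PiM I (\<lambda>_. M))"
      then have "indicator (Pi\<^sub>E I A) x = (\<Prod>i\<in>I. indicator (A i) (x i) :: ennreal)"
        using assms(3) by (auto simp: space_PiM PiE_iff indicator_def extensional_def prod_eq_1_iff intro!: prod_zero)
      then show "(\<Prod>i\<in>I. f (x i)) * indicator (Pi\<^sub>E I A) x = (\<Prod>i\<in>I. f (x i) * indicator (A i) (x i))"
        by (simp add: prod.distrib)
    qed
    also have "\<dots> = (\<Prod>i\<in>I. \<integral>\<^sup>+x. f x * indicator (A i) x \<partial>M)"
      using A' by (intro M.product_nn_integral_prod assms(3)) auto
    also have "\<dots> = (\<Prod>i\<in>I. emeasure (density M f) (A i))"
      using A' by (intro prod.cong refl) (simp add: emeasure_density)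
    finally show "emeasure (density (PiM I (\<lambda>_. M)) (\<lambda>x. \<Prod>i\<in>I. f (x i))) (Pi\<^sub>E I A)
        = (\<Prod>i\<in>I. emeasure (density M f) (A i))" .
  qed
  then show ?thesis ..
qed

lemma iid_unit_gaussian_shift:
  "iid n (unit_gaussian (m + d)) = density (iid n (unit_gaussian m)) (\<lambda>x. ennreal (exp (d * (\<Sum>i<n. x i - m) - real n * d\<^sup>2 / 2)))"
proof -
  interpret P: prob_space "unit_gaussian m" by (rule prob_space_unit_gaussian)
  have "sigma_finite_measure (unit_gaussian (m + d))"
    by (simp add: prob_space_unit_gaussian prob_space_imp_sigma_finite)
  then have "iid n (unit_gaussian (m + d)) = density (iid n (unit_gaussian m)) (\<lambda>x. \<Prod>i<n. ennreal (exp (d * (x i - m) - d\<^sup>2 / 2)))"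
    unfolding unit_gaussian_shift_density
    by (intro PiM_density) (auto simp: P.sigma_finite_measure_axioms)
  also have "(\<lambda>x. \<Prod>i<n. ennreal (exp (d * (x i - m) - d\<^sup>2 / 2)))
      = (\<lambda>x. ennreal (exp (d * (\<Sum>i<n. x i - m) - real n * d\<^sup>2 / 2)))"
  proof
    fix x :: "nat \<Rightarrow> real"
    have "(\<Prod>i<n. ennreal (exp (d * (x i - m) - d\<^sup>2 / 2))) = ennreal (exp (\<Sum>i<n. d * (x i - m) - d\<^sup>2 / 2))"
      by (simp add: prod_ennreal exp_sum)
    also have "(\<Sum>i<n. d * (x i - m) - d\<^sup>2 / 2) = d * (\<Sum>i<n. x i - m) - real n * d\<^sup>2 / 2"
      by (simp add: sum_subtractf sum_distrib_left[symmetric])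
    finally show "(\<Prod>i<n. ennreal (exp (d * (x i - m) - d\<^sup>2 / 2)))
        = ennreal (exp (d * (\<Sum>i<n. x i - m) - real n * d\<^sup>2 / 2))" .
  qed
  finally show ?thesis .
qed

lemma unit_gaussian_square_integrable_distribution: "square_integrable_distribution (unit_gaussian m)"
proof -
  interpret prob_space "unit_gaussian m" by (rule prob_space_unit_gaussian)
  show ?thesis by unfold_locales (auto simp: sq_unit_gaussian)
qed

lemma sets_iid_unit_gaussian: "sets (iid n (unit_gaussian m)) = sets (PiM {..<n} (\<lambda>_. borel))"
  by (intro sets_PiM_cong) auto

text \<open>The likelihood ratio is an exponential of \<open>d (\<Sum>i<n. X i - m)\<close>, and by Chebyshev this sum
exceeds \<open>2 sqrt n\<close> in absolute value with probability at most \<open>1/4\<close>.\<close>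

lemma unit_gaussian_shift_measure_ge:
  assumes n: "n > 0" and B: "B \<in> sets (PiM {..<n} (\<lambda>_. borel))"
  shows "measure (iid n (unit_gaussian (m + d))) B
    \<ge> exp (- (real n * d\<^sup>2 / 2) - 2 * \<bar>d\<bar> * sqrt (real n)) * (measure (iid n (unit_gaussian m)) B - 1/4)"
proof -
  interpret S: square_integrable_distribution "unit_gaussian m" by (rule unit_gaussian_square_integrable_distribution)
  interpret Q: prob_space "iid n (unit_gaussian m)" by (rule S.prob_space_iid)
  interpret S': square_integrable_distribution "unit_gaussian (m + d)" by (rule unit_gaussian_square_integrable_distribution)
  interpret R: prob_space "iid n (unit_gaussian (m + d))" by (rule S'.prob_space_iid)
  define c where "c = exp (- (real n * d\<^sup>2 / 2) - 2 * \<bar>d\<bar> * sqrt (real n))"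
  define Z where "Z X = (\<Sum>i<n. X i - m)" for X :: "nat \<Rightarrow> real"
  define G where "G = {X \<in> space (iid n (unit_gaussian m)). \<bar>Z X\<bar> \<ge> 2 * sqrt (real n)}"
  have B' [measurable]: "B \<in> sets (iid n (unit_gaussian m))" using B by (simp add: sets_iid_unit_gaussian)
  have [measurable]: "Z \<in> borel_measurable (iid n (unit_gaussian m))" unfolding Z_def[abs_def] by measurable
  have G [measurable]: "G \<in> sets (iid n (unit_gaussian m))" unfolding G_def by measurable
  have "measure (iid n (unit_gaussian m)) G \<le> real n * 1 / (2 * sqrt (real n))\<^sup>2"
    using S.chebyshev_sum[of "{..<n}" n "2 * sqrt (real n)"] n
    by (simp add: G_def Z_def mean_unit_gaussian std_dev_unit_gaussian)
  also have "\<dots> = 1/4" using n by (simp add: power_mult_distrib)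
  finally have "measure (iid n (unit_gaussian m)) G \<le> 1/4" .
  moreover have "measure (iid n (unit_gaussian m)) B \<le> measure (iid n (unit_gaussian m)) (B - G) + measure (iid n (unit_gaussian m)) G"
  proof -
    have "measure (iid n (unit_gaussian m)) B \<le> measure (iid n (unit_gaussian m)) ((B - G) \<union> G)"
      by (intro Q.finite_measure_mono) auto
    also have "\<dots> \<le> measure (iid n (unit_gaussian m)) (B - G) + measure (iid n (unit_gaussian m)) G"
      by (intro measure_Un_le) auto
    finally show ?thesis .
  qed
  ultimately have BG: "measure (iid n (unit_gaussian m)) B - 1/4 \<le> measure (iid n (unit_gaussian m)) (B - G)" by linarith
  have "ennreal (c * measure (iid n (unit_gaussian m)) (B - G)) = ennreal c * emeasure (iid n (unit_gaussian m)) (B - G)"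
    by (simp add: Q.emeasure_eq_measure ennreal_mult' c_def)
  also have "\<dots> = (\<integral>\<^sup>+x. ennreal c * indicator (B - G) x \<partial>iid n (unit_gaussian m))"
    by (simp add: nn_integral_cmult_indicator)
  also have "\<dots> \<le> (\<integral>\<^sup>+x. ennreal (exp (d * Z x - real n * d\<^sup>2 / 2)) * indicator B x \<partial>iid n (unit_gaussian m))"
  proof (rule nn_integral_mono)
    fix x assume x: "x \<in> space (iid n (unit_gaussian m))"
    show "ennreal c * indicator (B - G) x \<le> ennreal (exp (d * Z x - real n * d\<^sup>2 / 2)) * indicator B x"
    proof (cases "x \<in> B - G")
      case True
      then have "\<bar>Z x\<bar> \<le> 2 * sqrt (real n)" using x by (simp add: G_def)
      then have "\<bar>d\<bar> * \<bar>Z x\<bar> \<le> \<bar>d\<bar> * (2 * sqrt (real n))" by (intro mult_left_mono) auto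
      then have "d * Z x \<ge> - (2 * \<bar>d\<bar> * sqrt (real n))"
        using abs_ge_minus_self[of "d * Z x"] by (simp add: abs_mult)
      then have "c \<le> exp (d * Z x - real n * d\<^sup>2 / 2)" by (simp add: c_def)
      then show ?thesis using True by (simp add: ennreal_leI)
    qed simp
  qed
  also have "\<dots> = emeasure (iid n (unit_gaussian (m + d))) B"
    unfolding iid_unit_gaussian_shift Z_def[symmetric] by (subst emeasure_density) auto
  also have "\<dots> = ennreal (measure (iid n (unit_gaussian (m + d))) B)" by (rule R.emeasure_eq_measure)
  finally have "c * measure (iid n (unit_gaussian m)) (B - G) \<le> measure (iid n (unit_gaussian (m + d))) B"
    by (simp add: ennreal_le_iff)
  moreover have "c * (measure (iid n (unit_gaussian m)) B - 1/4) \<le> c * measure (iid n (unit_gaussian m)) (B - G)"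
    by (intro mult_left_mono BG) (simp add: c_def)
  ultimately show ?thesis unfolding c_def by linarith
qed

text \<open>The sets of samples on which \<open>g\<close> is within \<open>r\<close> of \<open>t\<close> and of \<open>-t\<close> are disjoint. Under mean \<open>0\<close>
either the first set or its complement has probability at least \<open>1/2\<close>, and then the change of
measure shows that \<open>g\<close> errs under mean \<open>-t\<close> or under mean \<open>t\<close>, respectively.\<close>

lemma two_point_lower_bound:
  fixes g :: "(nat \<Rightarrow> real) \<Rightarrow> real"
  assumes n: "n > 0" and g: "g \<in> borel_measurable (Pi\<^sub>M {..<n} (\<lambda>_. borel))"
    and r: "r < t" "0 < t"
    and good: "\<And>m. measure (iid n (unit_gaussian m)) {X \<in> space (iid n (unit_gaussian m)). \<bar>g X - m\<bar> \<le> r} \<ge> 1 - \<delta>"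
  shows "exp (- (real n * t\<^sup>2 / 2) - 2 * t * sqrt (real n)) \<le> 4 * \<delta>"
proof -
  let ?S = "space (PiM {..<n} (\<lambda>_. borel :: real measure))"
  define A where "A m = {X \<in> ?S. \<bar>g X - m\<bar> \<le> r}" for m
  define c where "c = exp (- (real n * t\<^sup>2 / 2) - 2 * t * sqrt (real n))"
  have sp: "space (iid n (unit_gaussian m)) = ?S" for m by (simp add: space_PiM)
  have A [measurable]: "A m \<in> sets (PiM {..<n} (\<lambda>_. borel))" for m
    unfolding A_def using g by measurable
  have P: "prob_space (iid n (unit_gaussian m))" for m
    using unit_gaussian_square_integrable_distribution by (rule square_integrable_distribution.prob_space_iid)
  have compl: "measure (iid n (unit_gaussian m)) (?S - B) = 1 - measure (iid n (unit_gaussian m)) B"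
    if "B \<in> sets (PiM {..<n} (\<lambda>_. borel))" for m B
    using prob_space.prob_compl[OF P[of m], of B] that unfolding sp sets_iid_unit_gaussian by simp
  have miss: "measure (iid n (unit_gaussian m)) (?S - A m) \<le> \<delta>" for m
    using good[of m] compl[OF A, of m m] by (simp add: A_def sp)
  have shift: "c / 4 \<le> measure (iid n (unit_gaussian d)) B"
    if "\<bar>d\<bar> = t" "B \<in> sets (PiM {..<n} (\<lambda>_. borel))" "measure (iid n (unit_gaussian 0)) B \<ge> 1/2" for d B
  proof -
    have "d\<^sup>2 = t\<^sup>2" using that(1) by (metis power2_abs)
    then have "c * (measure (iid n (unit_gaussian 0)) B - 1/4) \<le> measure (iid n (unit_gaussian d)) B"
      using unit_gaussian_shift_measure_ge[OF n that(2), where m = 0 and d = d] that(1) by (simp add: c_def)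
    moreover have "c * (1/4) \<le> c * (measure (iid n (unit_gaussian 0)) B - 1/4)"
      using that(3) by (intro mult_left_mono) (auto simp: c_def)
    ultimately show ?thesis by simp
  qed
  have "c / 4 \<le> \<delta>"
  proof (cases "measure (iid n (unit_gaussian 0)) (A t) \<ge> 1/2")
    case True
    have "c / 4 \<le> measure (iid n (unit_gaussian (- t))) (A t)" by (rule shift) (use r True in auto)
    also have "\<dots> \<le> measure (iid n (unit_gaussian (- t))) (?S - A (- t))"
    proof (rule finite_measure.finite_measure_mono)
      show "finite_measure (iid n (unit_gaussian (- t)))" by (rule prob_space.finite_measure[OF P])
      show "A t \<subseteq> ?S - A (- t)" using r by (auto simp: A_def)
      show "?S - A (- t) \<in> sets (iid n (unit_gaussian (- t)))" unfolding sets_iid_unit_gaussian by measurable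
    qed
    also have "\<dots> \<le> \<delta>" by (rule miss)
    finally show ?thesis .
  next
    case False
    have "c / 4 \<le> measure (iid n (unit_gaussian t)) (?S - A t)"
      by (rule shift) (use r False compl[OF A, of 0 t] in auto)
    also have "\<dots> \<le> \<delta>" by (rule miss)
    finally show ?thesis .
  qed
  then show ?thesis by (simp add: c_def)
qed

text \<open>With \<open>t = (1 - \<xi>/2) sqrt (2 L / n)\<close> \<open>two_point_lower_bound\<close> bounds the worse error probability below by
\<open>exp (- (1 - \<xi>/2)\<^sup>2 L - (2 - \<xi>) sqrt (2 L)) / 4\<close>. It exceeds \<open>\<delta> = exp (- L)\<close> once
\<open>L > 20 / \<xi>\<^sup>2\<close>.\<close>

theorem no_better_estimator:
  fixes \<xi> :: real
  assumes \<xi>: "0 < \<xi>" "\<xi> < 1"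
  shows "\<exists>\<tau>>0. \<forall>(n::nat) (\<delta>::real). n > 0 \<and> 0 < \<delta> \<and> \<delta> < 1 \<and>
          ln (1 / \<delta>) / real n < \<tau> \<and> \<delta> < \<tau> \<longrightarrow>
          \<not> (\<exists>g :: (nat \<Rightarrow> real) \<Rightarrow> real.
               g \<in> borel_measurable (Pi\<^sub>M {..<n} (\<lambda>_. borel)) \<and>
               (\<forall>D :: real measure. gaussian D \<longrightarrow>
                  \<P>(X in iid n D.
                     \<bar>g X - mean D\<bar>
                       \<le> std_dev D * (1 - \<xi>) * sqrt (2 * ln (1 / \<delta>) / real n)) \<ge> 1 - \<delta>))"
proof (intro exI[of _ "exp (- 20 / \<xi>\<^sup>2)"] conjI allI impI notI)
  fix n :: nat and \<delta> :: real
  assume A: "n > 0 \<and> 0 < \<delta> \<and> \<delta> < 1 \<and> ln (1 / \<delta>) / real n < exp (- 20 / \<xi>\<^sup>2) \<and> \<delta> < exp (- 20 / \<xi>\<^sup>2)"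
  define L where "L = ln (1 / \<delta>)"
  assume "\<exists>g :: (nat \<Rightarrow> real) \<Rightarrow> real.
               g \<in> borel_measurable (Pi\<^sub>M {..<n} (\<lambda>_. borel)) \<and>
               (\<forall>D :: real measure. gaussian D \<longrightarrow>
                  \<P>(X in iid n D.
                     \<bar>g X - mean D\<bar>
                       \<le> std_dev D * (1 - \<xi>) * sqrt (2 * ln (1 / \<delta>) / real n)) \<ge> 1 - \<delta>)"
  then obtain g :: "(nat \<Rightarrow> real) \<Rightarrow> real" where g: "g \<in> borel_measurable (Pi\<^sub>M {..<n} (\<lambda>_. borel))"
    and good: "\<And>D. gaussian D \<Longrightarrow> \<P>(X in iid n D. \<bar>g X - mean D\<bar>
                       \<le> std_dev D * (1 - \<xi>) * sqrt (2 * L / real n)) \<ge> 1 - \<delta>"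
    unfolding L_def by blast
  have "ln \<delta> < ln (exp (- 20 / \<xi>\<^sup>2))" using A by (subst ln_less_cancel_iff) auto
  then have L: "L > 20 / \<xi>\<^sup>2" using A by (simp add: L_def ln_div)
  then have L0: "L > 0" using \<xi> by (smt (verit) divide_nonneg_nonneg zero_le_power2)
  define t where "t = (1 - \<xi> / 2) * sqrt (2 * L / real n)"
  have t: "t > 0" "(1 - \<xi>) * sqrt (2 * L / real n) < t" using \<xi> L0 A by (auto simp: t_def)
  have "exp (- (real n * t\<^sup>2 / 2) - 2 * t * sqrt (real n)) \<le> 4 * \<delta>"
  proof (rule two_point_lower_bound[OF _ g t(2,1)])
    show "n > 0" using A by simp
    show "measure (iid n (unit_gaussian m)) {X \<in> space (iid n (unit_gaussian m)).
        \<bar>g X - m\<bar> \<le> (1 - \<xi>) * sqrt (2 * L / real n)} \<ge> 1 - \<delta>" for m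
      using good[OF gaussian_unit_gaussian[of m]] by (simp add: mean_unit_gaussian std_dev_unit_gaussian)
  qed
  also have "real n * t\<^sup>2 / 2 = (1 - \<xi> / 2)\<^sup>2 * L"
    using A L0 by (simp add: t_def power_mult_distrib)
  also have "2 * t * sqrt (real n) = 2 * (1 - \<xi> / 2) * sqrt (2 * L)"
    using A by (simp add: t_def real_sqrt_divide)
  also have "4 * \<delta> \<le> exp (2 - L)"
  proof -
    have "(4::real) \<le> exp 1 ^ 2" using power_mono[of 2 "exp 1 :: real" 2] exp_ge_add_one_self[of 1] by simp
    then have "(4::real) \<le> exp 2" by (simp add: exp_of_nat_mult[symmetric])
    moreover have "exp (- L) = \<delta>" using A by (simp add: L_def ln_div)
    ultimately show ?thesis using A by (simp add: exp_diff exp_minus field_simps)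
  qed
  finally have "exp (- ((1 - \<xi> / 2)\<^sup>2 * L) - 2 * (1 - \<xi> / 2) * sqrt (2 * L)) \<le> exp (2 - L)" .
  then have "L * (1 - (1 - \<xi> / 2)\<^sup>2) \<le> 2 * (1 - \<xi> / 2) * sqrt (2 * L) + 2"
    by (simp add: algebra_simps)
  moreover have "2 * (1 - \<xi> / 2) * sqrt (2 * L) \<le> 2 * sqrt (2 * L)"
    using \<xi> L0 by (intro mult_right_mono) auto
  moreover have "2 * sqrt (2 * L) \<le> \<xi> * L / 4 + 8 / \<xi>"
  proof -
    have "\<xi> * L / 4 * (8 / \<xi>) = 2 * L" using \<xi> by simp
    then show ?thesis using arith_geo_mean_sqrt[of "\<xi> * L / 4" "8 / \<xi>"] \<xi> L0 by simp
  qed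
  moreover have "L * (1 - (1 - \<xi> / 2)\<^sup>2) \<ge> 3/4 * (\<xi> * L)"
  proof -
    have "1 - (1 - \<xi> / 2)\<^sup>2 = \<xi> - \<xi> * \<xi> / 4" by (simp add: power2_eq_square algebra_simps)
    moreover have "\<xi> * \<xi> \<le> \<xi>" using \<xi> by simp
    ultimately have "1 - (1 - \<xi> / 2)\<^sup>2 \<ge> 3/4 * \<xi>" by simp
    then have "L * (1 - (1 - \<xi> / 2)\<^sup>2) \<ge> L * (3/4 * \<xi>)" using L0 by (intro mult_left_mono) auto
    then show ?thesis by (simp add: mult_ac)
  qed
  moreover have "\<xi> * L > 20 / \<xi>"
  proof -
    have "\<xi> * (20 / \<xi>\<^sup>2) < \<xi> * L" using L \<xi> by (intro mult_strict_left_mono) auto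
    then show ?thesis using \<xi> by (simp add: power2_eq_square)
  qed
  moreover have "8 / \<xi> = 8 * (1 / \<xi>)" "20 / \<xi> = 20 * (1 / \<xi>)" "1 / \<xi> > 1" using \<xi> by simp_all
  ultimately show False by linarith
qed simp

section \<open>Sub-Gaussian mean estimation with the optimal constant\<close>

theorem theorem1:
  fixes P :: "nat \<Rightarrow> real \<Rightarrow> nat \<Rightarrow> nat set"
  assumes "partition_scheme P"
  shows
    "(\<forall>\<xi>::real. \<xi> > 0 \<longrightarrow>
       (\<exists>\<tau>>0. \<forall>(n::nat) (\<delta>::real). n > 0 \<and> 0 < \<delta> \<and> \<delta> < 1 \<and>
          ln (1 / \<delta>) / real n < \<tau> \<and> \<delta> < \<tau> \<longrightarrow>
          (\<forall>D :: real measure. real_distribution D \<and> integrable D (\<lambda>x. x\<^sup>2) \<longrightarrow>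
             \<P>(X in iid n D.
                \<bar>main_estimator P n \<delta> X - mean D\<bar>
                  \<le> std_dev D * (1 + \<xi>) * sqrt (2 * ln (1 / \<delta>) / real n)) \<ge> 1 - \<delta>)))
     \<and>
     (\<forall>\<xi>::real. 0 < \<xi> \<and> \<xi> < 1 \<longrightarrow>
       (\<exists>\<tau>>0. \<forall>(n::nat) (\<delta>::real). n > 0 \<and> 0 < \<delta> \<and> \<delta> < 1 \<and>
          ln (1 / \<delta>) / real n < \<tau> \<and> \<delta> < \<tau> \<longrightarrow>
          \<not> (\<exists>g :: (nat \<Rightarrow> real) \<Rightarrow> real.
               g \<in> borel_measurable (Pi\<^sub>M {..<n} (\<lambda>_. borel)) \<and>
               (\<forall>D :: real measure. gaussian D \<longrightarrow>
                  \<P>(X in iid n D.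
                     \<bar>g X - mean D\<bar>
                       \<le> std_dev D * (1 - \<xi>) * sqrt (2 * ln (1 / \<delta>) / real n)) \<ge> 1 - \<delta>))))"
proof (intro conjI allI impI)
  fix \<xi> :: real
  assume "\<xi> > 0"
  with assms show "\<exists>\<tau>>0. \<forall>(n::nat) (\<delta>::real). n > 0 \<and> 0 < \<delta> \<and> \<delta> < 1 \<and>
          ln (1 / \<delta>) / real n < \<tau> \<and> \<delta> < \<tau> \<longrightarrow>
          (\<forall>D :: real measure. real_distribution D \<and> integrable D (\<lambda>x. x\<^sup>2) \<longrightarrow>
             \<P>(X in iid n D.
                \<bar>main_estimator P n \<delta> X - mean D\<bar>
                  \<le> std_dev D * (1 + \<xi>) * sqrt (2 * ln (1 / \<delta>) / real n)) \<ge> 1 - \<delta>)"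
    by (rule main_estimator_upper_bound)
next
  fix \<xi> :: real
  assume "0 < \<xi> \<and> \<xi> < 1"
  then show "\<exists>\<tau>>0. \<forall>(n::nat) (\<delta>::real). n > 0 \<and> 0 < \<delta> \<and> \<delta> < 1 \<and>
          ln (1 / \<delta>) / real n < \<tau> \<and> \<delta> < \<tau> \<longrightarrow>
          \<not> (\<exists>g :: (nat \<Rightarrow> real) \<Rightarrow> real.
               g \<in> borel_measurable (Pi\<^sub>M {..<n} (\<lambda>_. borel)) \<and>
               (\<forall>D :: real measure. gaussian D \<longrightarrow>
                  \<P>(X in iid n D.
                     \<bar>g X - mean D\<bar>
                       \<le> std_dev D * (1 - \<xi>) * sqrt (2 * ln (1 / \<delta>) / real n)) \<ge> 1 - \<delta>))"
    by (intro no_better_estimator) auto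
qed

end
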